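(* Let $V$ be a real separable Hilbert space and let $a,b,m$ be symmetric bilinear forms on $V$ such that $a$ is continuous and $V$-coercive, $b$ is weakly continuous, and $m$ is weakly continuous with $m(u,u)>0$ for all nonzero $u\in V$. Let $\mu_*\in\mathbb{R}$ with $\mu_*\notin\sigma(a,m)$ be fixed. Suppose $(s_1,t_1),\dots,(s_n,t_n)$ are finite intervals, each $(s_i,t_i)$ being a component of some (not necessarily the same) superlevel set $\{\mu_j>\mu_*\}$. (Two such intervals are either nested, with either endpoint possibly in common, or disjoint.) If $(s_i,t_i)=(s_j,t_j)$ for some $i\ne j$, then these intervals are assumed to be components of two distinct eigencurves. Then $$\mu_n(\lambda)\le\mu_*\qquad\text{for all }\lambda\in(-\infty,\hat s\,]\cup[\,\hat t,\infty),$$ where $\hat s:=\min\{s_1,\dots,s_n\}$ and $\hat t:=\max\{t_1,\dots,t_n\}$.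
   Context: "$a$ is continuous and $V$-coercive" means there are constants $0<\kappa_1\le\kappa_2<\infty$ with $\kappa_1\|u\|^2\le a(u,u)\le\kappa_2\|u\|^2$ for all $u\in V$. A symmetric bilinear form $b$ on $V$ is weakly continuous if $u_j\rightharpoonup u$ and $v_j\rightharpoonup v$ weakly in $V$ imply $b(u_j,v_j)\to b(u,v)$. $\sigma(a,m)$ is the set of $\mu\in\mathbb{R}$ for which there is a nonzero $u\in V$ with $a(u,v)=\mu\,m(u,v)$ for all $v\in V$. For $\lambda\in\mathbb{R}$ and $n\in\mathbb{N}$ (with $n\le\dim V$ if $V$ is finite dimensional), $\mu_n(\lambda)$ is the $n$-th smallest, counted with multiplicity, of the real numbers $\mu$ for which there is a nonzero $u\in V$ with $a(u,v)-\lambda b(u,v)=\mu\,m(u,v)$ for all $v\in V$; equivalently $\mu_n(\lambda)=\inf_{Z_n}\sup_{0\ne v\in Z_n}\frac{a(v,v)-\lambda b(v,v)}{m(v,v)}$ over $n$-dimensional subspaces $Z_n$ of $V$. The $n$-th eigencurve is the graph of $\lambda\mapsto\mu_n(\lambda)$. $\{\mu_n>\mu_*\}:=\{\lambda\in\mathbb{R}:\mu_n(\lambda)>\mu_*\}$. A finite interval $(s,t)$ is a component of $\{\mu_n>\mu_*\}$ (also said: a component of the $n$-th eigencurve above $\mu_*$) if $\mu_n(s)=\mu_n(t)=\mu_*$ and $\mu_n(\lambda)>\mu_*$ for all $s<\lambda<t$. *)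

theory Defs
  imports "HOL-Analysis.Analysis"
begin

text \<open>The Hilbert space \<open>V\<close> is the universe of a type of sort \<open>{real_inner, banach}\<close>.\<close>

definition symmetric_bilinear :: "('v::real_vector \<Rightarrow> 'v \<Rightarrow> real) \<Rightarrow> bool" where
  "symmetric_bilinear c \<longleftrightarrow> bilinear c \<and> (\<forall>u v. c u v = c v u)"

definition continuous_coercive :: "('v::real_normed_vector \<Rightarrow> 'v \<Rightarrow> real) \<Rightarrow> bool" where
  "continuous_coercive a \<longleftrightarrow>
     (\<exists>\<kappa>1 \<kappa>2. 0 < \<kappa>1 \<and> \<kappa>1 \<le> \<kappa>2 \<and>
        (\<forall>u. \<kappa>1 * (norm u)\<^sup>2 \<le> a u u \<and> a u u \<le> \<kappa>2 * (norm u)\<^sup>2))"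

definition weakly_converges :: "(nat \<Rightarrow> 'v::real_inner) \<Rightarrow> 'v \<Rightarrow> bool" where
  "weakly_converges x l \<longleftrightarrow> (\<forall>w. (\<lambda>k. inner (x k) w) \<longlonglongrightarrow> inner l w)"

definition weakly_continuous_form :: "('v::real_inner \<Rightarrow> 'v \<Rightarrow> real) \<Rightarrow> bool" where
  "weakly_continuous_form c \<longleftrightarrow>
     (\<forall>x y u v. weakly_converges x u \<longrightarrow> weakly_converges y v \<longrightarrow>
        (\<lambda>k. c (x k) (y k)) \<longlonglongrightarrow> c u v)"

definition form_eigenspace ::
    "('v::real_vector \<Rightarrow> 'v \<Rightarrow> real) \<Rightarrow> ('v \<Rightarrow> 'v \<Rightarrow> real) \<Rightarrow> real \<Rightarrow> 'v set" where
  "form_eigenspace c m \<mu> = {u. \<forall>v. c u v = \<mu> * m u v}"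

definition form_spectrum ::
    "('v::real_vector \<Rightarrow> 'v \<Rightarrow> real) \<Rightarrow> ('v \<Rightarrow> 'v \<Rightarrow> real) \<Rightarrow> real set" where
  "form_spectrum c m = {\<mu>. \<exists>u. u \<noteq> 0 \<and> (\<forall>v. c u v = \<mu> * m u v)}"

text \<open>
  The \<open>n\<close>-th smallest eigenvalue counted with multiplicity (\<open>n \<ge> 1\<close>) is the smallest eigenvalue
  \<open>\<mu>\<close> such that the multiplicities of the eigenvalues up to \<open>\<mu>\<close> add up to at least \<open>n\<close>.
  For forms as in the theorem every eigenspace is finite-dimensional and only finitely many
  eigenvalues lie below any bound, so the conventions for \<open>dim\<close> of an infinite-dimensional
  space and for sums over infinite sets play no role; the \<open>LEAST\<close> is attained whenever \<open>n\<close> does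
  not exceed the dimension of \<open>V\<close>.
\<close>

definition eigenvalue_nth ::
    "('v::real_vector \<Rightarrow> 'v \<Rightarrow> real) \<Rightarrow> ('v \<Rightarrow> 'v \<Rightarrow> real) \<Rightarrow> nat \<Rightarrow> real" where
  "eigenvalue_nth c m n =
     (LEAST \<mu>. \<mu> \<in> form_spectrum c m \<and>
        n \<le> (\<Sum>\<nu>\<in>{\<nu> \<in> form_spectrum c m. \<nu> \<le> \<mu>}. dim (form_eigenspace c m \<nu>)))"

definition eigencurve ::
    "('v::real_vector \<Rightarrow> 'v \<Rightarrow> real) \<Rightarrow> ('v \<Rightarrow> 'v \<Rightarrow> real) \<Rightarrow> ('v \<Rightarrow> 'v \<Rightarrow> real) \<Rightarrow> nat \<Rightarrow> real \<Rightarrow> real" where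
  "eigencurve a b m n r = eigenvalue_nth (\<lambda>u v. a u v - r * b u v) m n"

text \<open>
  The first two conjuncts say that the \<open>j\<close>-th eigencurve exists: \<open>j \<ge> 1\<close>, and \<open>j \<le> dim V\<close> if
  \<open>V\<close> is finite-dimensional.
\<close>

definition eigencurve_component ::
    "('v::real_vector \<Rightarrow> 'v \<Rightarrow> real) \<Rightarrow> ('v \<Rightarrow> 'v \<Rightarrow> real) \<Rightarrow> ('v \<Rightarrow> 'v \<Rightarrow> real) \<Rightarrow>
      real \<Rightarrow> nat \<Rightarrow> real \<Rightarrow> real \<Rightarrow> bool" where
  "eigencurve_component a b m \<mu>s j s t \<longleftrightarrow>
     1 \<le> j \<and>
     ((\<exists>B :: 'v set. finite B \<and> span B = UNIV) \<longrightarrow> j \<le> dim (UNIV :: 'v set)) \<and>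
     s < t \<and>
     eigencurve a b m j s = \<mu>s \<and> eigencurve a b m j t = \<mu>s \<and>
     (\<forall>r. s < r \<and> r < t \<longrightarrow> eigencurve a b m j r > \<mu>s)"

end

theory Submission
  imports Defs "HOL-Library.Diagonal_Subsequence"
begin

text \<open>
  Write \<open>q\<close> for \<open>a - \<mu>s m\<close>. Some eigencurve takes the value \<open>\<mu>s\<close> at \<open>\<sigma>\<close> exactly when \<open>q - \<sigma> b\<close>
  has a nontrivial kernel \<open>E \<sigma>\<close>, and by the min-max principle the \<open>n\<close>-th eigencurve is at most \<open>\<mu>s\<close> at \<open>r\<close> as soon as
  \<open>q - r b \<le> 0\<close> on some \<open>n\<close>-dimensional space. The proof builds such a space for all \<open>r\<close> to the left of
  the components from the left endpoints; the right endpoints are treated by replacing \<open>b\<close> by \<open>-b\<close>.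

  To first order, an eigenvalue that passes through \<open>\<mu>s\<close> at \<open>\<sigma>\<close> with eigenvector \<open>u\<close> moves with slope
  \<open>- b u u / m u u\<close>. Therefore, if \<open>p\<close> eigencurves rise above \<open>\<mu>s\<close> immediately to the right of \<open>\<sigma>\<close>, the
  kernel \<open>E \<sigma>\<close> contains a \<open>p\<close>-dimensional subspace \<open>W \<sigma>\<close> on which \<open>b \<le> 0\<close>. The proof of this
  does not differentiate the curves: \<open>E \<sigma>\<close> is split into a part \<open>P\<close> on which \<open>b\<close> is positive and a part on which
  \<open>b \<le> 0\<close> (\<open>positive_nonpositive_splitting\<close>), and \<open>P\<close> together with the eigenvectors below \<open>\<mu>s\<close> stays a
  test space for slightly larger parameters (\<open>perturbed_test_space\<close>), which limits the number of curves that
  can rise (\<open>components_with_common_left_end\<close>).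

  For different endpoints \<open>\<sigma> \<noteq> \<tau>\<close> the kernels are orthogonal with respect to \<open>b\<close>, because
  \<open>\<sigma> b u v = q u v = \<tau> b u v\<close> for \<open>u\<close> in \<open>E \<sigma>\<close> and \<open>v\<close> in \<open>E \<tau>\<close>. They form a direct sum because \<open>q\<close> is
  nondegenerate, which is the assumption that \<open>\<mu>s\<close> is not an eigenvalue of \<open>a\<close>
  (\<open>pencil_eigenvectors_direct_sum\<close>). So the sum of the \<open>W \<sigma>\<close> has dimension at least \<open>n\<close>, and for a
  vector \<open>z = \<Sum>\<sigma>. w \<sigma>\<close> in it \<open>q z z - r b z z = \<Sum>\<sigma>. (\<sigma> - r) b (w \<sigma>) (w \<sigma>) \<le> 0\<close> whenever
  \<open>r\<close> is at most every \<open>\<sigma>\<close>.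

  The eigenvalues are defined by multiplicities of eigenspaces, so the min-max principle has to be derived.
  Weak sequential compactness and a Garding inequality (\<open>garding_inequality\<close>) show that the Rayleigh quotient
  attains its minimum on orthogonal complements; hence a maximal orthonormal family of eigenvectors with
  eigenvalues up to \<open>\<mu>\<close> is finite, and the form exceeds \<open>\<mu> m\<close> on its complement
  (\<open>spectral_basis_complement\<close>). Comparing dimensions gives \<open>card_le_eigenvalue_count\<close>.
\<close>

section \<open>Weak sequential compactness in separable Hilbert spaces\<close>

text \<open>
  This is the first-order condition at a minimum, without derivatives: a quadratic function of
  \<open>\<tau>\<close> that vanishes at \<open>0\<close> and is never negative has no linear term.
\<close>

lemma linear_coefficient_zero_if_nonneg:
  fixes p q :: real
  assumes "\<And>\<tau>. 0 \<le> 2 * \<tau> * p + \<tau>\<^sup>2 * q"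
  shows "p = 0"
proof (rule ccontr)
  assume p: "p \<noteq> 0"
  define k where "k = \<bar>q\<bar> + 1"
  have k: "k > 0" "q < k" by (auto simp: k_def)
  have "0 \<le> 2 * (- p / k) * p + (- p / k)\<^sup>2 * q"
    by (rule assms)
  also have "\<dots> = p\<^sup>2 / k\<^sup>2 * (q - 2 * k)"
    using k by (simp add: field_simps power2_eq_square)
  also have "\<dots> < 0"
    using p k by (intro mult_pos_neg) auto
  finally show False by simp
qed

text \<open>
  The representing vector is the minimiser of \<open>\<parallel>x\<parallel>\<^sup>2 - 2 f x\<close>. The parallelogram law forces minimising
  sequences of this functional to be Cauchy, so completeness yields a minimiser, and the first-order
  condition there says that \<open>f\<close> is the inner product with it.
\<close>

theorem riesz_representation:
  fixes f :: "'v::{real_inner, banach} \<Rightarrow> real"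
  assumes "bounded_linear f"
  obtains l where "\<And>x. f x = inner x l"
proof -
  interpret f: bounded_linear f by fact
  obtain K where K: "\<And>x. norm (f x) \<le> norm x * K"
    using f.bounded by blast
  \<comment> \<open>completing the square gives the same functional as \<open>\<parallel>x - l\<parallel>\<^sup>2\<close> up to a constant\<close>
  define J where "J x = (norm x)\<^sup>2 - 2 * f x" for x
  define d where "d = (INF x. J x)"
  have "- K\<^sup>2 \<le> J x" for x
  proof -
    have "0 \<le> (norm x - K)\<^sup>2" by simp
    moreover have "f x \<le> norm x * K" using K[of x] by auto
    ultimately show ?thesis by (simp add: J_def power2_diff)
  qed
  then have bdd: "bdd_below (range J)" by (intro bdd_belowI) auto
  have d_le: "d \<le> J x" for x
    unfolding d_def by (rule cINF_lower[OF bdd]) auto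
  have "\<exists>x. J x < d + e" if "e > 0" for e
    using cINF_less_iff[OF _ bdd, of "d + e"] that unfolding d_def[symmetric] by auto
  then have "\<exists>x. \<forall>k. J (x k) < d + 1 / real (Suc k)"
    by (intro choice) auto
  then obtain x where x: "\<And>k. J (x k) < d + 1 / real (Suc k)" by blast
  have parallelogram: "(norm (y - z))\<^sup>2 \<le> 2 * (J y - d) + 2 * (J z - d)" for y z
  proof -
    have "(norm (y - z))\<^sup>2 = 2 * J y + 2 * J z - 4 * J ((1/2) *\<^sub>R (y + z))"
      by (simp add: J_def f.scaleR f.add power2_norm_eq_inner inner_simps inner_commute
          power_mult_distrib power_divide field_simps)
    with d_le[of "(1/2) *\<^sub>R (y + z)"] show ?thesis by (simp add: algebra_simps)
  qed
  have "Cauchy x"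
  proof (rule metric_CauchyI)
    fix e :: real assume e: "e > 0"
    \<comment> \<open>the parallelogram estimate allows \<open>2/(N+1)\<close> for each of the two indices\<close>
    obtain N where "4 / e\<^sup>2 < real N"
      using reals_Archimedean2 by blast
    then have N: "4 / e\<^sup>2 < real (Suc N)" by simp
    have "dist (x i) (x k) < e" if "i \<ge> N" "k \<ge> N" for i k
    proof -
      have *: "1 / real (Suc i) \<le> 1 / real (Suc N)" "1 / real (Suc k) \<le> 1 / real (Suc N)"
        using that by (auto simp: frac_le)
      have "(norm (x i - x k))\<^sup>2 < 4 * (1 / real (Suc N))"
        using parallelogram[of "x i" "x k"] x[of i] x[of k] * by (smt (verit))
      also have "\<dots> < e\<^sup>2" using N e by (simp add: field_simps)
      finally show ?thesis
        using e by (simp add: dist_norm power2_less_imp_less)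
    qed
    then show "\<exists>N. \<forall>i\<ge>N. \<forall>k\<ge>N. dist (x i) (x k) < e" by blast
  qed
  then obtain l where l: "x \<longlonglongrightarrow> l" using Cauchy_convergent convergentD by blast
  have "(\<lambda>k. J (x k)) \<longlonglongrightarrow> J l"
    unfolding J_def by (intro tendsto_intros l f.tendsto)
  moreover have "(\<lambda>k. d + 1 / real (Suc k)) \<longlonglongrightarrow> d + 0"
    using LIMSEQ_inverse_real_of_nat by (intro tendsto_intros) (simp add: inverse_eq_divide)
  ultimately have "J l \<le> d + 0"
    using x by (meson LIMSEQ_le less_imp_le)
  then have min: "J l \<le> J y" for y using d_le[of y] by linarith
  have "f w = inner w l" for w
  proof -
    have "0 \<le> 2 * \<tau> * (inner w l - f w) + \<tau>\<^sup>2 * (norm w)\<^sup>2" for \<tau>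
    proof -
      have "(norm (l + \<tau> *\<^sub>R w))\<^sup>2 = (norm l)\<^sup>2 + 2 * \<tau> * inner w l + \<tau>\<^sup>2 * (norm w)\<^sup>2"
        unfolding power2_norm_eq_inner inner_simps
        by (simp add: inner_commute power2_eq_square algebra_simps)
      then show ?thesis
        using min[of "l + \<tau> *\<^sub>R w"] by (simp add: J_def f.add f.scaleR algebra_simps)
    qed
    from linear_coefficient_zero_if_nonneg[OF this] show ?thesis by simp
  qed
  then show ?thesis by (rule that)
qed

lemma weakly_converges_const: "weakly_converges (\<lambda>_. l) l"
  by (simp add: weakly_converges_def)

lemma weakly_converges_bounded_linear:
  fixes f :: "'v::{real_inner, banach} \<Rightarrow> real"
  assumes "weakly_converges x l" "bounded_linear f"
  shows "(\<lambda>k. f (x k)) \<longlonglongrightarrow> f l"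
proof -
  obtain w where "\<And>y. f y = inner y w" using riesz_representation[OF assms(2)] by blast
  with assms(1) show ?thesis by (simp add: weakly_converges_def)
qed

text \<open>
  A diagonal argument makes the inner products with a countable dense set converge; boundedness of the
  sequence extends the convergence to all vectors. The limit functional is bounded, and its Riesz
  representative is the weak limit.
\<close>

theorem bounded_imp_weakly_convergent_subsequence:
  fixes x :: "nat \<Rightarrow> 'v::{real_inner, banach}"
  assumes sep: "separable_space (euclidean :: 'v topology)" and bound: "\<And>k. norm (x k) \<le> R"
  obtains r l where "strict_mono r" "weakly_converges (x \<circ> r) l"
proof -
  obtain D :: "'v set" where D: "countable D" "closure D = UNIV"
    using sep unfolding separable_space_def by auto
  then have "D \<noteq> {}" by auto
  define d where "d = from_nat_into D"
  have range_d: "range d = D" using D \<open>D \<noteq> {}\<close> by (simp add: d_def)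
  have R: "R \<ge> 0" using bound[of 0] norm_ge_zero order_trans by blast
  interpret subseqs "\<lambda>n s. convergent (\<lambda>k. inner (x (s k)) (d n))"
  proof
    fix n and s :: "nat \<Rightarrow> nat"
    have "bounded (range (\<lambda>k. inner (x (s k)) (d n)))"
    proof (rule boundedI)
      fix y assume "y \<in> range (\<lambda>k. inner (x (s k)) (d n))"
      then obtain k where "y = inner (x (s k)) (d n)" by auto
      then show "norm y \<le> R * norm (d n)"
        using Cauchy_Schwarz_ineq2[of "x (s k)" "d n"] bound[of "s k"]
        by (smt (verit) mult_right_mono norm_ge_zero real_norm_def)
    qed
    from bounded_imp_convergent_subsequence[OF this]
    obtain l r where "strict_mono r" "((\<lambda>k. inner (x (s k)) (d n)) \<circ> r) \<longlonglongrightarrow> l" by metis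
    then show "\<exists>r'. strict_mono r' \<and> convergent (\<lambda>k. inner (x ((s \<circ> r') k)) (d n))"
      by (auto simp: convergent_def o_def)
  qed
  have conv_d: "convergent (\<lambda>k. inner (x (diagseq k)) (d n))" for n
  proof -
    have "convergent (\<lambda>k. inner (x ((diagseq \<circ> ((+) (Suc n))) k)) (d n))"
    proof (rule diagseq_holds)
      fix r s :: "nat \<Rightarrow> nat" and n
      assume "strict_mono r" "convergent (\<lambda>k. inner (x (s k)) (d n))"
      then show "convergent (\<lambda>k. inner (x ((s \<circ> r) k)) (d n))"
        using convergent_subseq_convergent by (fastforce simp: o_def)
    qed
    then have "convergent (\<lambda>k. inner (x (diagseq (k + Suc n))) (d n))"
      by (simp add: o_def add.commute)
    then show ?thesis by (subst (asm) convergent_ignore_initial_segment)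
  qed
  have conv: "convergent (\<lambda>k. inner (x (diagseq k)) w)" for w
  proof -
    have "Cauchy (\<lambda>k. inner (x (diagseq k)) w)"
    proof (rule metric_CauchyI)
      fix e :: real assume e: "e > 0"
      define \<delta> where "\<delta> = e / (3 * (R + 1))"
      have "\<delta> > 0" using e R by (simp add: \<delta>_def)
      then obtain n where n: "dist (d n) w < \<delta>"
        using D range_d closure_approachable[of w D] by (metis UNIV_I imageE)
      have close: "\<bar>inner y w - inner y (d n)\<bar> < e / 3" if "norm y \<le> R" for y
      proof -
        have "\<bar>inner y w - inner y (d n)\<bar> \<le> norm y * norm (w - d n)"
          using Cauchy_Schwarz_ineq2[of y "w - d n"] by (simp add: inner_diff_right)
        also have "\<dots> \<le> R * \<delta>"
          using n that R by (intro mult_mono) (auto simp: dist_norm norm_minus_commute)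
        also have "\<dots> < (R + 1) * \<delta>" using \<open>\<delta> > 0\<close> by simp
        also have "\<dots> = e / 3" using R by (simp add: \<delta>_def field_simps)
        finally show ?thesis .
      qed
      have "Cauchy (\<lambda>k. inner (x (diagseq k)) (d n))"
        using conv_d convergent_Cauchy by blast
      then obtain N where N: "\<And>i k. i \<ge> N \<Longrightarrow> k \<ge> N \<Longrightarrow>
          \<bar>inner (x (diagseq i)) (d n) - inner (x (diagseq k)) (d n)\<bar> < e / 3"
        using metric_CauchyD[of _ "e/3"] e by (fastforce simp: dist_real_def)
      have "dist (inner (x (diagseq i)) w) (inner (x (diagseq k)) w) < e" if "i \<ge> N" "k \<ge> N" for i k
        using close[OF bound[of "diagseq i"]] close[OF bound[of "diagseq k"]] N[OF that]
        unfolding dist_real_def by linarith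
      then show "\<exists>N. \<forall>i\<ge>N. \<forall>k\<ge>N.
          dist (inner (x (diagseq i)) w) (inner (x (diagseq k)) w) < e" by blast
    qed
    then show ?thesis using Cauchy_convergent by blast
  qed
  define f where "f w = lim (\<lambda>k. inner (x (diagseq k)) w)" for w
  have f: "(\<lambda>k. inner (x (diagseq k)) w) \<longlonglongrightarrow> f w" for w
    unfolding f_def using conv convergent_LIMSEQ_iff by blast
  have "bounded_linear f"
  proof (rule bounded_linear_intro)
    show "f (y + z) = f y + f z" for y z
      using LIMSEQ_unique[OF f[of "y + z"]] tendsto_add[OF f[of y] f[of z]]
      by (simp add: inner_add_right)
    show "f (c *\<^sub>R y) = c *\<^sub>R f y" for c y
      using LIMSEQ_unique[OF f[of "c *\<^sub>R y"]] tendsto_mult_left[OF f[of y], of c] by simp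
    show "norm (f y) \<le> norm y * R" for y
    proof (rule LIMSEQ_le_const2[OF tendsto_norm[OF f]])
      have "norm (inner (x (diagseq k)) y) \<le> norm y * R" for k
        using Cauchy_Schwarz_ineq2[of "x (diagseq k)" y] bound[of "diagseq k"]
        by (smt (verit) mult.commute mult_right_mono norm_ge_zero real_norm_def)
      then show "\<exists>N. \<forall>k\<ge>N. norm (inner (x (diagseq k)) y) \<le> norm y * R" by blast
    qed
  qed
  then obtain l where l: "\<And>w. f w = inner w l" using riesz_representation by blast
  have "weakly_converges (x \<circ> diagseq) l"
    using f by (simp add: weakly_converges_def l inner_commute)
  with subseq_diagseq show ?thesis by (rule that)
qed

section \<open>Symmetric bilinear forms and independent sets\<close>

lemma symmetric_bilinearI:
  assumes "\<And>x y z. c (x + y) z = c x z + c y z" "\<And>r x y. c (r *\<^sub>R x) y = r * c x y"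
    "\<And>x y. c x y = c y x"
  shows "symmetric_bilinear c"
proof -
  have "linear (\<lambda>y. c x y)" for x
    by (rule linearI) (metis assms(1,3), metis assms(2,3) real_scaleR_def)
  moreover have "linear (\<lambda>x. c x y)" for y
    by (rule linearI) (auto simp: assms(1,2))
  ultimately show ?thesis
    unfolding symmetric_bilinear_def bilinear_def using assms(3) by blast
qed

lemma
  assumes "symmetric_bilinear c"
  shows form_commute: "c x y = c y x"
    and form_add_left: "c (x + y) z = c x z + c y z"
    and form_add_right: "c z (x + y) = c z x + c z y"
    and form_diff_left: "c (x - y) z = c x z - c y z"
    and form_diff_right: "c z (x - y) = c z x - c z y"
    and form_scale_left: "c (r *\<^sub>R x) y = r * c x y"
    and form_scale_right: "c x (r *\<^sub>R y) = r * c x y"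
    and form_zero_left: "c 0 x = 0"
    and form_zero_right: "c x 0 = 0"
    and form_linear_left: "linear (\<lambda>x. c x y)"
    and form_linear_right: "linear (c x)"
proof -
  have lin: "linear (\<lambda>x. c x y)" "linear (c x)" for x y
    using assms unfolding symmetric_bilinear_def bilinear_def by auto
  show "c x y = c y x" using assms unfolding symmetric_bilinear_def by blast
  show "c (x + y) z = c x z + c y z" "c (x - y) z = c x z - c y z" "c (r *\<^sub>R x) y = r * c x y" "c 0 x = 0"
    using linear_add[OF lin(1)] linear_diff[OF lin(1)] linear_scale[OF lin(1)] linear_0[OF lin(1)] by auto
  show "c z (x + y) = c z x + c z y" "c z (x - y) = c z x - c z y" "c x (r *\<^sub>R y) = r * c x y" "c x 0 = 0"
    using linear_add[OF lin(2)] linear_diff[OF lin(2)] linear_scale[OF lin(2)] linear_0[OF lin(2)] by auto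
  show "linear (\<lambda>x. c x y)" "linear (c x)" by (fact lin)+
qed

lemma
  assumes "symmetric_bilinear c"
  shows form_sum_left: "c (sum f A) y = (\<Sum>i\<in>A. c (f i) y)"
    and form_sum_right: "c y (sum f A) = (\<Sum>i\<in>A. c y (f i))"
  using linear_sum[OF form_linear_left[OF assms]] linear_sum[OF form_linear_right[OF assms]]
  by auto

lemmas form_simps = form_add_left form_add_right form_diff_left form_diff_right form_scale_left
  form_scale_right form_zero_left form_zero_right form_sum_left form_sum_right

lemma form_zero_on_span:
  assumes "symmetric_bilinear c" "\<And>y. y \<in> B \<Longrightarrow> c x y = 0" "y \<in> span B"
  shows "c x y = 0"
  using linear_eq_0_on_span[OF form_linear_right[OF assms(1)] assms(2,3)] by simp

text \<open>
  Each linear functional lowers the dimension by at most one. Dimension is counted by the size of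
  finite independent sets, so that the ambient space may be infinite dimensional. The lemma is used twice: it finds test vectors orthogonal to an eigenbasis, and it
  provides the \<open>b\<close>-orthogonal complement of a positive subspace.
\<close>

lemma independent_zero_set_of_functionals:
  fixes B :: "'v::real_vector set" and f :: "'i \<Rightarrow> 'v \<Rightarrow> real"
  assumes "finite S" "finite B" "independent B" "\<And>e. e \<in> S \<Longrightarrow> linear (f e)"
  shows "\<exists>C. C \<subseteq> span B \<and> finite C \<and> independent C \<and> (\<forall>e\<in>S. \<forall>x\<in>span C. f e x = 0)
    \<and> card B \<le> card C + card S"
  using assms(1,4)
proof (induction S rule: finite_induct)
  case empty
  then show ?case using assms(2,3) by (intro exI[of _ B]) (auto simp: span_superset)
next
  case (insert e S)
  then obtain C where C: "C \<subseteq> span B" "finite C" "independent C"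
    "\<And>e x. e \<in> S \<Longrightarrow> x \<in> span C \<Longrightarrow> f e x = 0" "card B \<le> card C + card S"
    by auto
  have lin: "linear (f e)" using insert.prems by simp
  define K where "K = {x \<in> span C. f e x = 0}"
  have subK: "subspace K"
    unfolding K_def subspace_def
    by (auto simp: span_zero span_add span_scale linear_0[OF lin] linear_add[OF lin] linear_scale[OF lin])
  obtain D where D: "D \<subseteq> K" "independent D" "K \<subseteq> span D"
    using maximal_independent_subset by blast
  have "span D \<subseteq> K" using D(1) subK span_minimal by blast
  have "D \<subseteq> span C" using D(1) K_def by auto
  then have finD: "finite D" using independent_span_bound C(2) D(2) by blast
  have "card C \<le> card D + 1"
  proof (cases "\<exists>u\<in>span C. f e u \<noteq> 0")
    case True
    then obtain u where u: "u \<in> span C" "f e u \<noteq> 0" by blast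
    have "C \<subseteq> span (insert u D)"
    proof
      fix x assume "x \<in> C"
      then have "x - (f e x / f e u) *\<^sub>R u \<in> K"
        using u by (auto simp: K_def span_base span_diff span_scale linear_diff[OF lin] linear_scale[OF lin])
      then show "x \<in> span (insert u D)" using D(3) span_breakdown_eq by blast
    qed
    then have "card C \<le> card (insert u D)"
      using independent_span_bound[of "insert u D" C] C(3) finD by simp
    also have "\<dots> \<le> card D + 1" using finD by (simp add: card_insert_if)
    finally show ?thesis .
  next
    case False
    then have "C \<subseteq> span D" using D(3) by (auto simp: K_def span_base)
    then show ?thesis
      using independent_span_bound[of D C] C(3) finD by simp
  qed
  moreover have "D \<subseteq> span B"
    using \<open>D \<subseteq> span C\<close> C(1) by (meson order_trans span_minimal subspace_span)
  moreover have "\<forall>e'\<in>insert e S. \<forall>x\<in>span D. f e' x = 0"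
    using \<open>span D \<subseteq> K\<close> C(4) by (auto simp: K_def)
  ultimately show ?case
    using finD D(2) C(5) insert.hyps by (intro exI[of _ D]) auto
qed

lemma span_Union_finite_decompose:
  fixes B :: "'i \<Rightarrow> 'v::real_vector set"
  assumes "finite I" "z \<in> span (\<Union>i\<in>I. B i)"
  obtains w where "\<And>i. i \<in> I \<Longrightarrow> w i \<in> span (B i)" "z = (\<Sum>i\<in>I. w i)"
  using assms
proof (induction I arbitrary: z thesis rule: finite_induct)
  case empty
  then show ?case by (metis UN_empty empty_iff singletonD span_empty sum.empty)
next
  case (insert i I)
  then have "z \<in> span (B i \<union> (\<Union>i\<in>I. B i))" by simp
  then obtain x y where xy: "z = x + y" "x \<in> span (B i)" "y \<in> span (\<Union>i\<in>I. B i)"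
    unfolding span_Un by blast
  obtain w where w: "\<And>i. i \<in> I \<Longrightarrow> w i \<in> span (B i)" "y = (\<Sum>i\<in>I. w i)"
    using insert.IH xy(3) by blast
  have "(\<Sum>k\<in>I. (w(i := x)) k) = (\<Sum>k\<in>I. w k)"
    using insert.hyps by (intro sum.cong) auto
  then have "z = (\<Sum>k\<in>insert i I. (w(i := x)) k)"
    using insert.hyps w(2) xy(1) by simp
  moreover have "(w(i := x)) k \<in> span (B k)" if "k \<in> insert i I" for k
    using that w(1) xy(2) by auto
  ultimately show ?case using insert.prems(1) by blast
qed

lemma independent_Union_direct_sum:
  fixes B :: "'i \<Rightarrow> 'v::real_vector set"
  assumes "finite I" and fin: "\<And>i. i \<in> I \<Longrightarrow> finite (B i)" and ind: "\<And>i. i \<in> I \<Longrightarrow> independent (B i)"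
    and direct: "\<And>w i. (\<And>i. i \<in> I \<Longrightarrow> w i \<in> span (B i)) \<Longrightarrow> (\<Sum>i\<in>I. w i) = 0 \<Longrightarrow> i \<in> I \<Longrightarrow> w i = 0"
  shows "independent (\<Union>i\<in>I. B i)" and "card (\<Union>i\<in>I. B i) = (\<Sum>i\<in>I. card (B i))"
proof -
  have disj: "B i \<inter> B k = {}" if "i \<in> I" "k \<in> I" "i \<noteq> k" for i k
  proof (rule ccontr)
    assume "B i \<inter> B k \<noteq> {}"
    then obtain x where x: "x \<in> B i" "x \<in> B k" by blast
    define w where "w l = (if l = i then x else if l = k then - x else 0)" for l
    have "(\<Sum>l\<in>I. w l) = (\<Sum>l\<in>{i, k}. w l)"
      using that \<open>finite I\<close> by (intro sum.mono_neutral_right) (auto simp: w_def)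
    also have "\<dots> = 0" using that by (simp add: w_def)
    finally have "w i = 0"
      using direct[of w i] x that by (auto simp: w_def span_base span_neg span_zero)
    then show False using x ind[OF that(1)] by (auto simp: w_def dependent_zero)
  qed
  then show "card (\<Union>i\<in>I. B i) = (\<Sum>i\<in>I. card (B i))"
    using assms(1) fin by (intro card_UN_disjoint) auto
  show "independent (\<Union>i\<in>I. B i)"
  proof (rule independent_if_scalars_zero)
    show "finite (\<Union>i\<in>I. B i)" using assms(1) fin by auto
    fix g x assume g: "(\<Sum>x\<in>(\<Union>i\<in>I. B i). g x *\<^sub>R x) = 0" and x: "x \<in> (\<Union>i\<in>I. B i)"
    then obtain i where i: "i \<in> I" "x \<in> B i" by blast
    have "(\<Sum>i\<in>I. \<Sum>x\<in>B i. g x *\<^sub>R x) = 0"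
      using g sum.UNION_disjoint[of I B "\<lambda>x. g x *\<^sub>R x"] assms(1) fin disj by simp
    then have "(\<Sum>x\<in>B i. g x *\<^sub>R x) = 0"
      using direct[of "\<lambda>i. \<Sum>x\<in>B i. g x *\<^sub>R x" i] i by (simp add: span_sum span_scale span_base)
    then show "g x = 0"
      using independentD[OF ind[OF i(1)] fin[OF i(1)] subset_refl _ i(2)] by blast
  qed
qed

section \<open>Orthonormal sets with respect to a positive form\<close>

definition orthonormal_for :: "('v \<Rightarrow> 'v \<Rightarrow> real) \<Rightarrow> 'v set \<Rightarrow> bool" where
  "orthonormal_for m S \<longleftrightarrow> (\<forall>x\<in>S. \<forall>y\<in>S. m x y = (if x = y then 1 else 0))"

lemma orthonormal_for_subset: "orthonormal_for m S \<Longrightarrow> T \<subseteq> S \<Longrightarrow> orthonormal_for m T"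
  unfolding orthonormal_for_def by blast

locale positive_form =
  fixes m :: "'v::real_vector \<Rightarrow> 'v \<Rightarrow> real"
  assumes m_form: "symmetric_bilinear m"
    and m_pos: "u \<noteq> 0 \<Longrightarrow> m u u > 0"
begin

lemmas m_simps = form_simps[OF m_form]

lemma m_nonneg: "m u u \<ge> 0"
  using m_pos[of u] by (cases "u = 0") (auto simp: m_simps)

lemma m_eq_0_iff: "m u u = 0 \<longleftrightarrow> u = 0"
  using m_pos[of u] by (cases "u = 0") (auto simp: m_simps)

lemma orthonormal_expansion:
  assumes "finite S" "orthonormal_for m S" "x \<in> span S"
  shows "x = (\<Sum>e\<in>S. m x e *\<^sub>R e)"
proof -
  obtain g where g: "x = (\<Sum>e\<in>S. g e *\<^sub>R e)"
    using assms(1,3) span_finite by auto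
  have "m x e = g e" if "e \<in> S" for e
  proof -
    have "m x e = (\<Sum>e'\<in>S. if e' = e then g e else 0)"
      unfolding g m_simps using assms(2) that
      by (intro sum.cong) (auto simp: orthonormal_for_def)
    then show ?thesis using assms(1) that by simp
  qed
  then show ?thesis using g by simp
qed

lemma parseval:
  assumes "finite S" "orthonormal_for m S" "x \<in> span S"
  shows "m x x = (\<Sum>e\<in>S. (m x e)\<^sup>2)"
proof -
  have "m x x = m x (\<Sum>e\<in>S. m x e *\<^sub>R e)"
    using orthonormal_expansion[OF assms] by simp
  then show ?thesis by (simp add: m_simps power2_eq_square)
qed

lemma residual_orthogonal:
  assumes "finite S" "orthonormal_for m S" "e \<in> S"
  shows "m (x - (\<Sum>e\<in>S. m x e *\<^sub>R e)) e = 0"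
proof -
  have "(\<Sum>e'\<in>S. m x e' * m e' e) = (\<Sum>e'\<in>S. if e' = e then m x e else 0)"
    using assms by (intro sum.cong) (auto simp: orthonormal_for_def)
  then show ?thesis using assms by (simp add: m_simps)
qed

lemma orthonormal_independent:
  assumes "orthonormal_for m S"
  shows "independent S"
  unfolding independent_explicit_finite_subsets
proof safe
  fix A g v assume A: "A \<subseteq> S" "finite A" "(\<Sum>v\<in>A. g v *\<^sub>R v) = 0" "v \<in> A"
  have on: "orthonormal_for m A" using assms A(1) unfolding orthonormal_for_def by blast
  have "0 = m (\<Sum>v\<in>A. g v *\<^sub>R v) v" using A by (simp add: m_simps)
  also have "\<dots> = (\<Sum>e\<in>A. if e = v then g v else 0)"
    unfolding m_simps using A(4) on by (intro sum.cong) (auto simp: orthonormal_for_def)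
  also have "\<dots> = g v" using A by simp
  finally show "g v = 0" by simp
qed

lemma normalize:
  assumes "u \<noteq> 0"
  shows "m ((1 / sqrt (m u u)) *\<^sub>R u) ((1 / sqrt (m u u)) *\<^sub>R u) = 1"
  using m_pos[OF assms] by (simp add: m_simps power2_eq_square[symmetric] field_simps)

lemma orthonormal_insert:
  assumes "orthonormal_for m S" "\<And>e. e \<in> S \<Longrightarrow> m u e = 0" "m u u = 1"
  shows "orthonormal_for m (insert u S)" "u \<notin> S"
  using assms form_commute[OF m_form] by (auto simp: orthonormal_for_def)

text \<open>
  One Gram--Schmidt step, inside a subspace that need not be finite dimensional: maximal orthonormal sets
  of eigenvectors are shown to span the eigenspaces by applying it to an eigenspace.
\<close>

lemma orthogonal_unit_vector:
  assumes "finite S" "orthonormal_for m S" "S \<subseteq> U" "subspace U" "u \<in> U" "u \<notin> span S"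
  obtains e where "e \<in> U" "m e e = 1" "\<And>f. f \<in> S \<Longrightarrow> m e f = 0"
proof -
  define r where "r = u - (\<Sum>e\<in>S. m u e *\<^sub>R e)"
  have "r \<noteq> 0" using assms(6) unfolding r_def
    by (metis (no_types, lifting) eq_iff_diff_eq_0 span_base span_scale span_sum)
  moreover have "r \<in> U" unfolding r_def using assms
    by (intro subspace_diff subspace_sum subspace_scale) auto
  moreover have "m r f = 0" if "f \<in> S" for f
    unfolding r_def using residual_orthogonal assms that by blast
  ultimately show ?thesis
    using that[of "(1 / sqrt (m r r)) *\<^sub>R r"] normalize[of r] assms(4)
    by (simp add: subspace_scale form_scale_left[OF m_form])
qed

text \<open>
  An orthonormal subset of the span with the largest possible cardinality spans it, since otherwise a
  Gram--Schmidt step would enlarge it.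
\<close>

lemma orthonormal_basis_exists:
  assumes "finite B"
  obtains S where "finite S" "orthonormal_for m S" "span S = span B"
proof -
  define ons where "ons S \<longleftrightarrow> finite S \<and> S \<subseteq> span B \<and> orthonormal_for m S" for S
  have bound: "card S \<le> card B" if "ons S" for S
    using that orthonormal_independent independent_span_bound[OF assms] by (auto simp: ons_def)
  have "ons {}" by (simp add: ons_def orthonormal_for_def)
  then obtain S where S: "ons S" "\<And>T. ons T \<Longrightarrow> card T \<le> card S"
    using ex_has_greatest_nat[of ons "{}" card "card B + 1"] bound by (auto simp: less_Suc_eq_le)
  have "u \<in> span S" if u: "u \<in> span B" for u
  proof (rule ccontr)
    assume "u \<notin> span S"
    moreover have "finite S" "orthonormal_for m S" "S \<subseteq> span B" using S(1) by (auto simp: ons_def)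
    ultimately obtain e where e: "e \<in> span B" "m e e = 1" "\<And>f. f \<in> S \<Longrightarrow> m e f = 0"
      using orthogonal_unit_vector[OF _ _ _ subspace_span u] by metis
    then have "ons (insert e S)" "e \<notin> S"
      using S(1) orthonormal_insert[of S e] by (auto simp: ons_def)
    then show False using S(2)[of "insert e S"] S(1) by (simp add: ons_def)
  qed
  then have "span S = span B"
    using S(1) by (auto simp: ons_def) (meson span_minimal subspace_span subsetD)
  with S(1) show ?thesis using that by (auto simp: ons_def)
qed

text \<open>
  On a finite-dimensional subspace every form is bounded relative to \<open>m\<close>; in an \<open>m\<close>-orthonormal basis the
  sum of the absolute values of the matrix entries is a possible bound.
\<close>

lemma form_bounded_on_finite_span:
  assumes c: "symmetric_bilinear c" and "finite B"
  obtains C where "C \<ge> 0" "\<And>x y. x \<in> span B \<Longrightarrow> y \<in> span B \<Longrightarrow> \<bar>c x y\<bar> \<le> C * sqrt (m x x) * sqrt (m y y)"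
proof -
  obtain S where S: "finite S" "orthonormal_for m S" "span S = span B"
    using orthonormal_basis_exists[OF \<open>finite B\<close>] by blast
  define C where "C = (\<Sum>e\<in>S. \<Sum>f\<in>S. \<bar>c e f\<bar>)"
  have coord: "\<bar>m x e\<bar> \<le> sqrt (m x x)" if "x \<in> span S" "e \<in> S" for x e
  proof -
    have "(m x e)\<^sup>2 \<le> (\<Sum>e\<in>S. (m x e)\<^sup>2)" using S(1) that by (intro member_le_sum) auto
    then show ?thesis using parseval[OF S(1,2) that(1)] by (simp add: real_le_rsqrt)
  qed
  have "\<bar>c x y\<bar> \<le> C * sqrt (m x x) * sqrt (m y y)" if x: "x \<in> span S" and y: "y \<in> span S" for x y
  proof -
    have "c x y = c (\<Sum>e\<in>S. m x e *\<^sub>R e) (\<Sum>e\<in>S. m y e *\<^sub>R e)"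
      using orthonormal_expansion[OF S(1,2)] x y by metis
    also have "\<dots> = (\<Sum>e\<in>S. m x e * c e (\<Sum>f\<in>S. m y f *\<^sub>R f))"
      by (simp only: form_sum_left[OF c] form_scale_left[OF c])
    also have "\<dots> = (\<Sum>e\<in>S. \<Sum>f\<in>S. m x e * (m y f * c e f))"
      by (simp only: form_sum_right[OF c] form_scale_right[OF c] sum_distrib_left)
    also have "\<bar>\<dots>\<bar> \<le> (\<Sum>e\<in>S. \<Sum>f\<in>S. sqrt (m x x) * (sqrt (m y y) * \<bar>c e f\<bar>))"
      using x y coord
      by (intro order_trans[OF sum_abs] sum_mono) (auto simp: abs_mult m_nonneg intro!: mult_mono)
    also have "\<dots> = C * sqrt (m x x) * sqrt (m y y)"
      by (simp add: C_def sum_distrib_left sum_distrib_right mult_ac)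
    finally show ?thesis .
  qed
  moreover have "C \<ge> 0" by (simp add: C_def sum_nonneg)
  ultimately show ?thesis using that S(3) by metis
qed

end

section \<open>Spectral theory and the min-max principle\<close>

definition eigenvalue_count ::
    "('v::real_vector \<Rightarrow> 'v \<Rightarrow> real) \<Rightarrow> ('v \<Rightarrow> 'v \<Rightarrow> real) \<Rightarrow> real \<Rightarrow> nat" where
  "eigenvalue_count c m \<mu> =
     (\<Sum>\<nu>\<in>{\<nu> \<in> form_spectrum c m. \<nu> \<le> \<mu>}. dim (form_eigenspace c m \<nu>))"

text \<open>
  A maximal \<open>m\<close>-orthonormal family of eigenvectors with eigenvalues at most \<open>\<mu>\<close>. The eigenvalue of a
  member \<open>e\<close> can be read off as \<open>c e e\<close>, because \<open>m e e = 1\<close>. It serves as a basis of the spectral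
  subspace of the eigenvalues up to \<open>\<mu>\<close>.
\<close>

definition spectral_basis ::
    "('v::real_vector \<Rightarrow> 'v \<Rightarrow> real) \<Rightarrow> ('v \<Rightarrow> 'v \<Rightarrow> real) \<Rightarrow> real \<Rightarrow> 'v set \<Rightarrow> bool" where
  "spectral_basis c m \<mu> S \<longleftrightarrow> finite S \<and> orthonormal_for m S \<and>
     (\<forall>e\<in>S. c e e \<le> \<mu> \<and> e \<in> form_eigenspace c m (c e e)) \<and>
     (\<forall>e \<nu>. \<nu> \<le> \<mu> \<longrightarrow> e \<in> form_eigenspace c m \<nu> \<longrightarrow> m e e = 1 \<longrightarrow> (\<exists>f\<in>S. m e f \<noteq> 0))"

lemma spectral_basisD:
  assumes "spectral_basis c m \<mu> S"
  shows "finite S" "orthonormal_for m S" "e \<in> S \<Longrightarrow> c e e \<le> \<mu>"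
    "e \<in> S \<Longrightarrow> e \<in> form_eigenspace c m (c e e)"
  using assms unfolding spectral_basis_def by blast+

text \<open>
  These are the properties of \<open>a - r b\<close> that the variational theory uses. The form itself need not be
  positive, but adding a multiple of \<open>m\<close> makes it coercive, which bounds minimising sequences; weak lower
  semicontinuity then makes the weak limits minimisers. The latter is only required along sequences on
  which the form converges, as it does along minimising sequences.
\<close>

locale garding_pair = positive_form m
  for m :: "'v::{real_inner, banach} \<Rightarrow> 'v \<Rightarrow> real" +
  fixes c :: "'v \<Rightarrow> 'v \<Rightarrow> real"
  assumes separable: "separable_space (euclidean :: 'v topology)"
    and c_form: "symmetric_bilinear c"
    and m_weak: "weakly_continuous_form m"
    and garding: "\<exists>\<alpha> K. 0 < \<alpha> \<and> (\<forall>u. \<alpha> * (norm u)\<^sup>2 \<le> c u u + K * m u u)"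
    and c_weakly_lsc: "weakly_converges x u \<Longrightarrow> (\<lambda>k. c (x k) (x k)) \<longlonglongrightarrow> L \<Longrightarrow> c u u \<le> L"
begin

abbreviation E where "E \<equiv> form_eigenspace c m"

lemmas c_simps = form_simps[OF c_form]

lemma m_tendsto:
  assumes "weakly_converges x u" "weakly_converges y v"
  shows "(\<lambda>k. m (x k) (y k)) \<longlonglongrightarrow> m u v"
  using m_weak assms unfolding weakly_continuous_form_def by blast

lemma eigenspaceD: "e \<in> E \<nu> \<Longrightarrow> c e v = \<nu> * m e v"
  by (simp add: form_eigenspace_def)

lemma subspace_eigenspace: "subspace (E \<nu>)"
  by (auto simp: subspace_def form_eigenspace_def c_simps m_simps algebra_simps)

lemma eigenspaces_orthogonal:
  assumes "u \<in> E \<nu>" "v \<in> E \<kappa>" "\<nu> \<noteq> \<kappa>"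
  shows "m u v = 0"
proof -
  have "\<nu> * m u v = c u v" by (rule eigenspaceD[OF assms(1), symmetric])
  also have "\<dots> = c v u" by (rule form_commute[OF c_form])
  also have "\<dots> = \<kappa> * m v u" by (rule eigenspaceD[OF assms(2)])
  also have "m v u = m u v" by (rule form_commute[OF m_form])
  finally show ?thesis using assms(3) by simp
qed

lemma weakly_convergent_subsequence:
  fixes x :: "nat \<Rightarrow> 'v"
  assumes "\<And>k. m (x k) (x k) = 1" "\<And>k. c (x k) (x k) \<le> M"
  obtains r l where "strict_mono r" "weakly_converges (x \<circ> r) l" "m l l = 1"
proof -
  obtain \<alpha> K where \<alpha>: "0 < \<alpha>" "\<And>u. \<alpha> * (norm u)\<^sup>2 \<le> c u u + K * m u u"
    using garding by blast
  have "norm (x k) \<le> sqrt ((M + K) / \<alpha>)" for k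
  proof (rule real_le_rsqrt)
    have "\<alpha> * (norm (x k))\<^sup>2 \<le> M + K" using \<alpha>(2)[of "x k"] assms[of k] by simp
    then show "(norm (x k))\<^sup>2 \<le> (M + K) / \<alpha>" using \<alpha>(1) by (simp add: field_simps)
  qed
  then obtain r l where r: "strict_mono r" "weakly_converges (x \<circ> r) l"
    by (rule bounded_imp_weakly_convergent_subsequence[OF separable, where x = x])
  have "(\<lambda>k. m ((x \<circ> r) k) ((x \<circ> r) k)) \<longlonglongrightarrow> m l l" by (intro m_tendsto r)
  then have "m l l = 1" using assms(1) by (simp add: LIMSEQ_const_iff)
  with r show ?thesis by (rule that)
qed

text \<open>
  This is the compactness behind the discreteness of the spectrum. An infinite orthonormal family on which
  \<open>c\<close> is bounded would have a weakly convergent sequence of members; its limit has \<open>m\<close>-norm \<open>1\<close> because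
  \<open>m\<close> is weakly continuous, although it is \<open>m\<close>-orthogonal to all members of the sequence.
\<close>

lemma finite_orthonormal_if_bounded:
  assumes S: "orthonormal_for m S" "\<And>e. e \<in> S \<Longrightarrow> c e e \<le> M"
  shows "finite S"
proof (rule ccontr)
  assume "infinite S"
  then obtain x :: "nat \<Rightarrow> 'v" where x: "inj x" "range x \<subseteq> S"
    using infinite_countable_subset by blast
  have ortho: "m (x i) (x k) = (if i = k then 1 else 0)" for i k
    using S(1) x by (auto simp: orthonormal_for_def inj_eq image_subset_iff)
  have "m (x k) (x k) = 1" "c (x k) (x k) \<le> M" for k
    using ortho S(2)[of "x k"] x(2) by (auto simp: image_subset_iff)
  then obtain r l where r: "strict_mono r" "weakly_converges (x \<circ> r) l" "m l l = 1"
    by (rule weakly_convergent_subsequence[where x = x])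
  have perp: "m l (x i) = 0" for i
  proof (rule LIMSEQ_unique)
    show "(\<lambda>k. m ((x \<circ> r) k) (x i)) \<longlonglongrightarrow> m l (x i)"
      by (intro m_tendsto r weakly_converges_const)
    have "eventually (\<lambda>k. m ((x \<circ> r) k) (x i) = 0) sequentially"
      using eventually_gt_at_top[of i]
    proof eventually_elim
      case (elim k)
      then have "r k \<noteq> i" using seq_suble[OF r(1), of k] by linarith
      then show ?case using ortho by simp
    qed
    then show "(\<lambda>k. m ((x \<circ> r) k) (x i)) \<longlonglongrightarrow> 0" by (rule tendsto_eventually)
  qed
  have "(\<lambda>k. m l ((x \<circ> r) k)) \<longlonglongrightarrow> m l l"
    by (intro m_tendsto r weakly_converges_const)
  then have "(\<lambda>_. 0) \<longlonglongrightarrow> m l l" by (simp only: o_apply perp)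
  then have "m l l = 0" using LIMSEQ_unique tendsto_const by blast
  then show False using r(3) by simp
qed

text \<open>
  Direct method: a minimising sequence of the Rayleigh quotient has a weak limit. The normalisation and the
  orthogonality constraints survive because \<open>m\<close> is weakly continuous, and \<open>c\<close> does not increase in the
  limit.
\<close>

lemma rayleigh_minimizer_exists:
  assumes z: "z \<noteq> 0" "\<And>e. e \<in> S \<Longrightarrow> m z e = 0"
  obtains u where "m u u = 1" "\<And>e. e \<in> S \<Longrightarrow> m u e = 0"
    "\<And>v. (\<And>e. e \<in> S \<Longrightarrow> m v e = 0) \<Longrightarrow> c u u * m v v \<le> c v v"
proof -
  obtain \<alpha> K where \<alpha>: "0 < \<alpha>" "\<And>u. \<alpha> * (norm u)\<^sup>2 \<le> c u u + K * m u u"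
    using garding by blast
  define X where "X = {v. m v v = 1 \<and> (\<forall>e\<in>S. m v e = 0)}"
  have normalized: "(1 / sqrt (m v v)) *\<^sub>R v \<in> X" if "v \<noteq> 0" "\<And>e. e \<in> S \<Longrightarrow> m v e = 0" for v
    using that normalize[of v] by (auto simp: X_def form_scale_left[OF m_form])
  have "X \<noteq> {}" using normalized[OF z] by auto
  define \<nu> where "\<nu> = (INF v\<in>X. c v v)"
  have "- K \<le> c v v" if "v \<in> X" for v
  proof -
    have "0 \<le> \<alpha> * (norm v)\<^sup>2" using \<alpha>(1) by simp
    then show ?thesis using \<alpha>(2)[of v] that by (simp add: X_def)
  qed
  then have bdd: "bdd_below ((\<lambda>v. c v v) ` X)" by (intro bdd_belowI) auto
  have \<nu>_le: "\<nu> \<le> c v v" if "v \<in> X" for v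
    unfolding \<nu>_def using that by (intro cINF_lower[OF bdd])
  have "\<exists>v. v \<in> X \<and> c v v < \<nu> + e" if "e > 0" for e
    using cINF_less_iff[OF \<open>X \<noteq> {}\<close> bdd, of "\<nu> + e"] that unfolding \<nu>_def[symmetric] by auto
  then have "\<exists>x. \<forall>k. x k \<in> X \<and> c (x k) (x k) < \<nu> + 1 / real (Suc k)"
    by (intro choice) auto
  then obtain x where x: "\<And>k. x k \<in> X" "\<And>k. c (x k) (x k) < \<nu> + 1 / real (Suc k)" by blast
  have "m (x k) (x k) = 1" "c (x k) (x k) \<le> \<nu> + 1" for k
  proof -
    have "1 / real (Suc k) \<le> 1" by simp
    then show "c (x k) (x k) \<le> \<nu> + 1" using x(2)[of k] by (smt (verit))
    show "m (x k) (x k) = 1" using x(1)[of k] by (simp add: X_def)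
  qed
  then obtain r u where r: "strict_mono r" "weakly_converges (x \<circ> r) u" "m u u = 1"
    by (rule weakly_convergent_subsequence[where x = x])
  have orth: "m u e = 0" if "e \<in> S" for e
  proof -
    have "(\<lambda>k. m ((x \<circ> r) k) e) \<longlonglongrightarrow> m u e"
      by (intro m_tendsto r weakly_converges_const)
    then show ?thesis using x(1) that by (simp add: X_def LIMSEQ_const_iff)
  qed
  have "(\<lambda>k. c (x k) (x k)) \<longlonglongrightarrow> \<nu>"
  proof (rule tendsto_sandwich)
    show "eventually (\<lambda>k. \<nu> \<le> c (x k) (x k)) sequentially" using \<nu>_le x(1) by simp
    show "eventually (\<lambda>k. c (x k) (x k) \<le> \<nu> + 1 / real (Suc k)) sequentially"
      using x(2) by (intro always_eventually allI less_imp_le)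
    have "(\<lambda>k. \<nu> + 1 / real (Suc k)) \<longlonglongrightarrow> \<nu> + 0"
      using LIMSEQ_inverse_real_of_nat by (intro tendsto_intros) (simp add: inverse_eq_divide)
    then show "(\<lambda>k. \<nu> + 1 / real (Suc k)) \<longlonglongrightarrow> \<nu>" by simp
  qed auto
  then have "(\<lambda>k. c ((x \<circ> r) k) ((x \<circ> r) k)) \<longlonglongrightarrow> \<nu>"
    using LIMSEQ_subseq_LIMSEQ[OF _ r(1)] by (fastforce simp: o_def)
  then have "c u u \<le> \<nu>" using c_weakly_lsc r(2) by blast
  have "c u u * m v v \<le> c v v" if v: "\<And>e. e \<in> S \<Longrightarrow> m v e = 0" for v
  proof (cases "v = 0")
    case False
    have "c u u \<le> c ((1 / sqrt (m v v)) *\<^sub>R v) ((1 / sqrt (m v v)) *\<^sub>R v)"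
      using \<nu>_le[OF normalized[OF False v]] \<open>c u u \<le> \<nu>\<close> by simp
    also have "\<dots> = c v v / m v v"
      using m_nonneg[of v] by (simp add: form_scale_left[OF c_form] form_scale_right[OF c_form])
    finally show ?thesis using m_pos[OF False] by (simp add: field_simps)
  qed (simp add: c_simps m_simps)
  with r(3) orth show ?thesis by (rule that)
qed

text \<open>
  The first-order condition only tests against vectors orthogonal to \<open>S\<close>. Testing against \<open>S\<close> itself is
  automatic, since the members of \<open>S\<close> are eigenvectors orthogonal to \<open>u\<close>.
\<close>

lemma rayleigh_minimizer_eigenvector:
  assumes S: "finite S" "orthonormal_for m S" "\<And>e. e \<in> S \<Longrightarrow> e \<in> E (c e e)"
    and u: "m u u = 1" "\<And>e. e \<in> S \<Longrightarrow> m u e = 0"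
    and min: "\<And>v. (\<And>e. e \<in> S \<Longrightarrow> m v e = 0) \<Longrightarrow> c u u * m v v \<le> c v v"
  shows "u \<in> E (c u u)"
proof -
  define D where "D v w = c v w - c u u * m v w" for v w
  have D_form: "symmetric_bilinear D"
  proof (rule symmetric_bilinearI)
    show "D (x + y) w = D x w + D y w" "D (k *\<^sub>R x) w = k * D x w" for x y w k
      by (simp_all add: D_def c_simps m_simps algebra_simps)
    show "D x y = D y x" for x y
      by (simp only: D_def form_commute[OF c_form, of x] form_commute[OF m_form, of x])
  qed
  note D_simps = form_simps[OF D_form]
  have D_S: "D u e = 0" if "e \<in> S" for e
  proof -
    have "c u e = c e u" by (rule form_commute[OF c_form])
    also have "\<dots> = c e e * m e u" by (rule eigenspaceD[OF S(3)[OF that]])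
    also have "m e u = m u e" by (rule form_commute[OF m_form])
    finally show ?thesis using u(2)[OF that] by (simp add: D_def)
  qed
  have D_perp: "D u v = 0" if v: "\<And>e. e \<in> S \<Longrightarrow> m v e = 0" for v
  proof (rule linear_coefficient_zero_if_nonneg)
    fix \<tau> :: real
    have "c u u * m (u + \<tau> *\<^sub>R v) (u + \<tau> *\<^sub>R v) \<le> c (u + \<tau> *\<^sub>R v) (u + \<tau> *\<^sub>R v)"
      using u(2) v by (intro min) (simp add: m_simps)
    then have "0 \<le> D (u + \<tau> *\<^sub>R v) (u + \<tau> *\<^sub>R v)" by (simp add: D_def)
    also have "\<dots> = D u u + \<tau> * D u v + \<tau> * D v u + \<tau>\<^sup>2 * D v v"
      unfolding D_simps by (simp add: power2_eq_square algebra_simps)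
    also have "D v u = D u v" by (rule form_commute[OF D_form])
    also have "D u u = 0" by (simp add: D_def u(1))
    finally show "0 \<le> 2 * \<tau> * D u v + \<tau>\<^sup>2 * D v v" by (simp add: algebra_simps)
  qed
  have "D u v = 0" for v
  proof -
    define p where "p = (\<Sum>e\<in>S. m v e *\<^sub>R e)"
    have "D u (v - p) = 0"
      unfolding p_def by (intro D_perp residual_orthogonal S)
    moreover have "D u p = 0" by (simp add: p_def D_simps D_S)
    ultimately show ?thesis by (simp add: D_simps)
  qed
  then show ?thesis unfolding form_eigenspace_def D_def eq_iff_diff_eq_0[symmetric] by blast
qed

lemma eigenvalue_of_unit_eigenvector: "e \<in> E \<nu> \<Longrightarrow> m e e = 1 \<Longrightarrow> c e e = \<nu>"
  by (simp add: eigenspaceD[of e \<nu>])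

lemma spectral_basis_exists: "\<exists>S. spectral_basis c m \<mu> S"
proof -
  define A where "A = {S. orthonormal_for m S \<and> (\<forall>e\<in>S. c e e \<le> \<mu> \<and> e \<in> E (c e e))}"
  have "\<exists>M\<in>A. \<forall>X\<in>A. M \<subseteq> X \<longrightarrow> X = M"
  proof (rule subset_Zorn')
    fix C assume C: "subset.chain A C"
    have "orthonormal_for m (\<Union>C)"
      unfolding orthonormal_for_def
    proof safe
      fix X Y x y assume "X \<in> C" "Y \<in> C" "x \<in> X" "y \<in> Y"
      then obtain Z where "Z \<in> A" "x \<in> Z" "y \<in> Z"
        using C unfolding subset_chain_def by blast
      then show "m x y = (if x = y then 1 else 0)" by (auto simp: A_def orthonormal_for_def)
    qed
    then show "\<Union>C \<in> A" using C unfolding subset_chain_def A_def by blast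
  qed
  then obtain S where S: "S \<in> A" "\<And>X. X \<in> A \<Longrightarrow> S \<subseteq> X \<Longrightarrow> X = S" by blast
  have "\<exists>f\<in>S. m e f \<noteq> 0" if e: "\<nu> \<le> \<mu>" "e \<in> E \<nu>" "m e e = 1" for e \<nu>
  proof (rule ccontr)
    assume "\<not> ?thesis"
    then have ortho: "orthonormal_for m (insert e S)" "e \<notin> S"
      using orthonormal_insert[of S e] S(1) e(3) by (auto simp: A_def)
    have "insert e S \<in> A"
      using ortho(1) S(1) e eigenvalue_of_unit_eigenvector[OF e(2,3)] by (auto simp: A_def)
    then show False using S(2) ortho(2) by blast
  qed
  moreover have "finite S"
    using S(1) by (intro finite_orthonormal_if_bounded[of _ \<mu>]) (auto simp: A_def)
  ultimately show ?thesis using S(1) by (auto simp: spectral_basis_def A_def)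
qed

text \<open>
  A member of the eigenspace outside this span would give, by a Gram--Schmidt step within the eigenspace, a
  new eigenvector; it is orthogonal to the remaining members of \<open>S\<close> as well, because these belong to other
  eigenvalues. This contradicts maximality.
\<close>

lemma spectral_basis_spans_eigenspace:
  assumes S: "spectral_basis c m \<mu> S" and "\<nu> \<le> \<mu>"
  shows "span {e \<in> S. c e e = \<nu>} = E \<nu>"
proof
  let ?T = "{e \<in> S. c e e = \<nu>}"
  have T: "?T \<subseteq> E \<nu>" using spectral_basisD(4)[OF S] by blast
  then show "span ?T \<subseteq> E \<nu>" by (rule span_minimal[OF _ subspace_eigenspace])
  show "E \<nu> \<subseteq> span ?T"
  proof (rule subsetI, rule ccontr)
    fix u assume u: "u \<in> E \<nu>" "u \<notin> span ?T"
    have fin: "finite ?T" and on: "orthonormal_for m ?T"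
      using spectral_basisD(1)[OF S] orthonormal_for_subset[OF spectral_basisD(2)[OF S]] by auto
    obtain e where e: "e \<in> E \<nu>" "m e e = 1" "\<And>f. f \<in> ?T \<Longrightarrow> m e f = 0"
      using orthogonal_unit_vector[OF fin on T subspace_eigenspace u] by blast
    obtain f where f: "f \<in> S" "m e f \<noteq> 0"
      using S \<open>\<nu> \<le> \<mu>\<close> e(1,2) unfolding spectral_basis_def by blast
    then have "c f f \<noteq> \<nu>" using e(3) by blast
    moreover have "f \<in> E (c f f)" using spectral_basisD(4)[OF S f(1)] .
    ultimately show False using eigenspaces_orthogonal[OF e(1)] f(2) by metis
  qed
qed

text \<open>
  If the strict inequality failed, the minimiser of the Rayleigh quotient on the orthogonal complement of
  \<open>S\<close> would be an eigenvector with eigenvalue at most \<open>\<mu>\<close> that could be added to \<open>S\<close>.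
\<close>

lemma spectral_basis_complement:
  assumes S: "spectral_basis c m \<mu> S" and z: "z \<noteq> 0" "\<And>e. e \<in> S \<Longrightarrow> m z e = 0"
  shows "\<mu> * m z z < c z z"
proof (rule ccontr)
  assume neg: "\<not> ?thesis"
  obtain u where u: "m u u = 1" "\<And>e. e \<in> S \<Longrightarrow> m u e = 0"
    "\<And>v. (\<And>e. e \<in> S \<Longrightarrow> m v e = 0) \<Longrightarrow> c u u * m v v \<le> c v v"
    using rayleigh_minimizer_exists[OF z] by metis
  have "u \<in> E (c u u)"
    using spectral_basisD[OF S] by (intro rayleigh_minimizer_eigenvector[OF _ _ _ u])
  moreover have "c u u * m z z \<le> \<mu> * m z z" using u(3)[OF z(2)] neg by simp
  then have "c u u \<le> \<mu>" using m_pos[OF z(1)] by simp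
  ultimately show False using S u(1,2) unfolding spectral_basis_def by blast
qed

lemma spectral_basis_spectrum:
  assumes S: "spectral_basis c m \<mu> S"
  shows "{\<nu> \<in> form_spectrum c m. \<nu> \<le> \<mu>} = (\<lambda>e. c e e) ` S"
proof safe
  fix \<nu> assume "\<nu> \<in> form_spectrum c m" "\<nu> \<le> \<mu>"
  then obtain u where u: "u \<noteq> 0" "u \<in> E \<nu>" by (auto simp: form_spectrum_def form_eigenspace_def)
  then have "{e \<in> S. c e e = \<nu>} \<noteq> {}"
    using spectral_basis_spans_eigenspace[OF S \<open>\<nu> \<le> \<mu>\<close>] by (metis singletonD span_empty)
  then show "\<nu> \<in> (\<lambda>e. c e e) ` S" by auto
next
  fix e assume e: "e \<in> S"
  then have "m e e = 1" using spectral_basisD(2)[OF S] by (simp add: orthonormal_for_def)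
  then have "e \<noteq> 0" by (auto simp: m_simps)
  moreover have "e \<in> E (c e e)" using spectral_basisD(4)[OF S e] .
  ultimately show "c e e \<in> form_spectrum c m"
    unfolding form_spectrum_def form_eigenspace_def by blast
  show "c e e \<le> \<mu>" using spectral_basisD(3)[OF S e] .
qed

lemma finite_spectrum_below: "finite {\<nu> \<in> form_spectrum c m. \<nu> \<le> \<mu>}"
proof -
  obtain S where S: "spectral_basis c m \<mu> S" using spectral_basis_exists by blast
  then have "finite S" by (rule spectral_basisD)
  then show ?thesis by (simp add: spectral_basis_spectrum[OF S])
qed

lemma eigenvalue_count_eq_card:
  assumes S: "spectral_basis c m \<mu> S"
  shows "eigenvalue_count c m \<mu> = card S"
proof -
  have fin: "finite S" and on: "orthonormal_for m S" using spectral_basisD[OF S] by auto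
  have "dim (E \<nu>) = card {e \<in> S. c e e = \<nu>}" if "\<nu> \<in> (\<lambda>e. c e e) ` S" for \<nu>
  proof -
    have "\<nu> \<le> \<mu>" using that spectral_basisD(3)[OF S] by auto
    have "independent {e \<in> S. c e e = \<nu>}"
      using independent_mono[OF orthonormal_independent[OF on]] by simp
    then show ?thesis
      unfolding spectral_basis_spans_eigenspace[OF S \<open>\<nu> \<le> \<mu>\<close>, symmetric]
      by (rule dim_span_eq_card_independent)
  qed
  then have "eigenvalue_count c m \<mu> = (\<Sum>\<nu>\<in>(\<lambda>e. c e e) ` S. card {e \<in> S. c e e = \<nu>})"
    by (simp add: eigenvalue_count_def spectral_basis_spectrum[OF S])
  also have "\<dots> = card S"
    using sum.image_gen[OF fin, of "\<lambda>_. 1::nat" "\<lambda>e. c e e"] by simp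
  finally show ?thesis .
qed

lemma eigenvalue_count_mono: "\<mu> \<le> \<mu>' \<Longrightarrow> eigenvalue_count c m \<mu> \<le> eigenvalue_count c m \<mu>'"
  unfolding eigenvalue_count_def by (intro sum_mono2 finite_spectrum_below) auto

text \<open>
  The half of the min-max principle that produces eigenvalues from test spaces: were the test space larger
  than a spectral basis, it would contain a nonzero vector orthogonal to that basis, where the form is too
  large.
\<close>

lemma card_le_eigenvalue_count:
  fixes B :: "'v set"
  assumes B: "finite B" "independent B" and neg: "\<And>z. z \<in> span B \<Longrightarrow> c z z \<le> \<mu> * m z z"
  shows "card B \<le> eigenvalue_count c m \<mu>"
proof (rule ccontr)
  assume less: "\<not> ?thesis"
  obtain S where S: "spectral_basis c m \<mu> S" using spectral_basis_exists by blast
  then have "finite S" by (rule spectral_basisD)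
  obtain C where C: "C \<subseteq> span B" "independent C" "\<forall>e\<in>S. \<forall>x\<in>span C. m x e = 0"
    "card B \<le> card C + card S"
    using independent_zero_set_of_functionals[OF \<open>finite S\<close> B, of "\<lambda>e x. m x e"]
      form_linear_left[OF m_form] by auto
  then have "card C \<noteq> 0" using less eigenvalue_count_eq_card[OF S] by simp
  then obtain z where z: "z \<in> C" by (metis card.empty equals0I)
  then have "z \<noteq> 0" using C(2) dependent_zero by blast
  then have "\<mu> * m z z < c z z"
    using spectral_basis_complement[OF S] C(3) z span_base by blast
  moreover have "c z z \<le> \<mu> * m z z" using neg C(1) z by blast
  ultimately show False by simp
qed

text \<open>
  The form is bounded above, relative to \<open>m\<close>, on any finite-dimensional space. Hence the \<open>n\<close>-th eigenvalue
  exists as soon as there are \<open>n\<close> independent vectors.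
\<close>

lemma card_le_eigenvalue_count_eventually:
  fixes B :: "'v set"
  assumes B: "finite B" "independent B"
  shows "\<exists>\<mu>. card B \<le> eigenvalue_count c m \<mu>"
proof -
  obtain C where C: "C \<ge> 0" "\<And>x y. x \<in> span B \<Longrightarrow> y \<in> span B \<Longrightarrow> \<bar>c x y\<bar> \<le> C * sqrt (m x x) * sqrt (m y y)"
    using form_bounded_on_finite_span[OF c_form \<open>finite B\<close>] by metis
  have "c z z \<le> C * m z z" if "z \<in> span B" for z
    using C(2)[OF that that] m_nonneg[of z] by (simp add: mult.assoc)
  then show ?thesis using card_le_eigenvalue_count[OF B] by blast
qed

text \<open>
  The \<open>LEAST\<close> in the definition of the \<open>n\<close>-th eigenvalue ranges over reals and could fail to be attained;
  here it is attained since only finitely many eigenvalues lie below \<open>\<mu>\<close>.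
\<close>

lemma eigenvalue_nth_least:
  assumes "1 \<le> n" "n \<le> eigenvalue_count c m \<mu>"
  shows "eigenvalue_nth c m n \<in> form_spectrum c m"
    and "eigenvalue_nth c m n \<le> \<mu>"
    and "n \<le> eigenvalue_count c m (eigenvalue_nth c m n)"
proof -
  define P where "P \<nu> \<longleftrightarrow> \<nu> \<in> form_spectrum c m \<and> n \<le> eigenvalue_count c m \<nu>" for \<nu>
  have nth: "eigenvalue_nth c m n = (LEAST \<nu>. P \<nu>)"
    by (simp add: eigenvalue_nth_def P_def eigenvalue_count_def)
  have ex: "\<exists>\<nu>. P \<nu> \<and> \<nu> \<le> \<mu>"
  proof -
    define T where "T = {\<nu> \<in> form_spectrum c m. \<nu> \<le> \<mu>}"
    have fin: "finite T" unfolding T_def by (rule finite_spectrum_below)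
    have ne: "T \<noteq> {}" using assms by (auto simp: eigenvalue_count_def T_def[symmetric])
    have "{\<nu> \<in> form_spectrum c m. \<nu> \<le> Max T} = T"
      using Max_in[OF fin ne] Max_ge[OF fin] unfolding T_def by fastforce
    then have "eigenvalue_count c m (Max T) = eigenvalue_count c m \<mu>"
      by (simp add: eigenvalue_count_def T_def)
    then show ?thesis using Max_in[OF fin ne] assms(2) unfolding P_def T_def by auto
  qed
  define A where "A = {\<nu>. P \<nu> \<and> \<nu> \<le> \<mu>}"
  have A: "finite A" "A \<noteq> {}"
    using ex finite_subset[OF _ finite_spectrum_below[of \<mu>], of A] by (auto simp: A_def P_def)
  have "(LEAST \<nu>. P \<nu>) = Min A"
  proof (rule Least_equality)
    show "P (Min A)" using Min_in[OF A] by (simp add: A_def)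
    fix \<nu> assume "P \<nu>"
    show "Min A \<le> \<nu>"
    proof (cases "\<nu> \<le> \<mu>")
      case True
      then show ?thesis using \<open>P \<nu>\<close> A(1) by (intro Min_le) (auto simp: A_def)
    next
      case False
      then show ?thesis using Min_in[OF A] by (simp add: A_def)
    qed
  qed
  then have "eigenvalue_nth c m n \<in> A" using Min_in[OF A] nth by simp
  then show "eigenvalue_nth c m n \<in> form_spectrum c m" "eigenvalue_nth c m n \<le> \<mu>"
    "n \<le> eigenvalue_count c m (eigenvalue_nth c m n)"
    by (auto simp: A_def P_def)
qed

end

section \<open>Moving an eigenvalue off its level\<close>

text \<open>
  Half of Sylvester's law of inertia. Take for \<open>P\<close> a largest subspace on which \<open>b\<close> is positive definite,
  uniformly with respect to \<open>m\<close>, and for \<open>W\<close> its \<open>b\<close>-orthogonal complement: a vector of \<open>W\<close> on which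
  \<open>b\<close> is positive could be added to \<open>P\<close>.
\<close>

lemma (in positive_form) positive_nonpositive_splitting:
  assumes b: "symmetric_bilinear b" and E0: "finite E0" "independent E0"
  obtains P W \<delta> where
    "finite P" "independent P" "P \<subseteq> span E0" "0 < \<delta>" "\<And>x. x \<in> span P \<Longrightarrow> \<delta> * m x x \<le> b x x"
    "finite W" "independent W" "W \<subseteq> span E0" "\<And>w. w \<in> span W \<Longrightarrow> b w w \<le> 0"
    "card E0 \<le> card P + card W"
proof -
  note b_simps = form_simps[OF b]
  define pos where "pos P \<longleftrightarrow> finite P \<and> P \<subseteq> span E0 \<and> independent P \<and>
    (\<exists>\<delta>>0. \<forall>x\<in>span P. \<delta> * m x x \<le> b x x)" for P
  have "pos {}" by (auto simp: pos_def b_simps m_simps independent_empty intro: exI[of _ 1])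
  moreover have "card P \<le> card E0" if "pos P" for P
    using that independent_span_bound[OF E0(1)] by (auto simp: pos_def)
  ultimately obtain P where P: "pos P" "\<And>Q. pos Q \<Longrightarrow> card Q \<le> card P"
    using ex_has_greatest_nat[of pos "{}" card "card E0 + 1"] by (auto simp: less_Suc_eq_le)
  obtain \<delta> where \<delta>: "0 < \<delta>" "\<And>x. x \<in> span P \<Longrightarrow> \<delta> * m x x \<le> b x x"
    and finP: "finite P" and PE: "P \<subseteq> span E0" and indP: "independent P"
    using P(1) unfolding pos_def by blast
  obtain W where W: "W \<subseteq> span E0" "finite W" "independent W"
      "\<And>p x. p \<in> P \<Longrightarrow> x \<in> span W \<Longrightarrow> b x p = 0" "card E0 \<le> card W + card P"
    using independent_zero_set_of_functionals[OF finP E0, of "\<lambda>p x. b x p"] form_linear_left[OF b]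
    by blast
  have "b w w \<le> 0" if w: "w \<in> span W" for w
  proof (rule ccontr)
    assume "\<not> b w w \<le> 0"
    then have bw: "0 < b w w" by simp
    have perp: "b w p = 0" if "p \<in> span P" for p
      using form_zero_on_span[OF b _ that] W(4) w by blast
    have "w \<notin> span P" using perp[of w] bw by auto
    have "w \<noteq> 0" using bw by (auto simp: b_simps)
    have "w \<in> span E0" using w W(1) by (meson span_minimal subspace_span subsetD)
    \<comment> \<open>a common constant for \<open>span P\<close> and the line through \<open>w\<close>; half of it is lost in \<open>m (p + k w) \<le> 2 m p + 2 m (k w)\<close>\<close>
    define \<gamma> where "\<gamma> = min \<delta> (b w w / m w w)"
    have mw: "0 < m w w" using m_pos[OF \<open>w \<noteq> 0\<close>] .
    have \<gamma>: "0 < \<gamma>" "\<gamma> \<le> \<delta>" "\<gamma> * m w w \<le> b w w"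
      using \<delta>(1) bw mw by (auto simp: \<gamma>_def min_def field_simps)
    have "\<gamma> / 2 * m x x \<le> b x x" if x: "x \<in> span (insert w P)" for x
    proof -
      obtain k where "x - k *\<^sub>R w \<in> span P" using x span_breakdown_eq by blast
      then obtain p where p: "p \<in> span P" "x = p + k *\<^sub>R w"
        by (metis diff_add_cancel)
      have "b p w = 0" using perp[OF p(1)] form_commute[OF b] by metis
      then have "b x x = b p p + k\<^sup>2 * b w w"
        using perp[OF p(1)] by (simp add: p(2) b_simps power2_eq_square)
      moreover have "\<gamma> * m p p \<le> b p p"
        using \<delta>(2)[OF p(1)] mult_right_mono[OF \<gamma>(2) m_nonneg[of p]] by linarith
      moreover have "k\<^sup>2 * (\<gamma> * m w w) \<le> k\<^sup>2 * b w w"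
        using \<gamma>(3) by (intro mult_left_mono) auto
      ultimately have *: "\<gamma> * (m p p + k\<^sup>2 * m w w) \<le> b x x" by (simp add: algebra_simps)
      have "0 \<le> m (p - k *\<^sub>R w) (p - k *\<^sub>R w)" by (rule m_nonneg)
      then have "m x x \<le> 2 * (m p p + k\<^sup>2 * m w w)"
        by (simp add: p(2) m_simps power2_eq_square algebra_simps)
      then have "\<gamma> / 2 * m x x \<le> \<gamma> / 2 * (2 * (m p p + k\<^sup>2 * m w w))"
        using \<gamma>(1) by (intro mult_left_mono) auto
      also have "\<dots> = \<gamma> * (m p p + k\<^sup>2 * m w w)" by simp
      finally show ?thesis using * by linarith
    qed
    moreover have "0 < \<gamma> / 2" using \<gamma>(1) by simp
    ultimately have "\<exists>\<delta>>0. \<forall>x\<in>span (insert w P). \<delta> * m x x \<le> b x x" by blast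
    moreover have "independent (insert w P)" by (rule independent_insertI[OF \<open>w \<notin> span P\<close> indP])
    ultimately have "pos (insert w P)"
      unfolding pos_def using finP PE \<open>w \<in> span E0\<close> by simp
    moreover have "w \<notin> P" using \<open>w \<notin> span P\<close> span_base by blast
    ultimately show False using P(2)[of "insert w P"] finP by simp
  qed
  with finP indP PE \<delta> W that show ?thesis by (simp add: add.commute)
qed

context garding_pair
begin

lemma spectral_basis_quadratic_bound:
  assumes F: "finite F" "orthonormal_for m F" "\<And>e. e \<in> F \<Longrightarrow> e \<in> E (c e e)" "\<And>e. e \<in> F \<Longrightarrow> c e e \<le> \<theta>"
    and f: "f \<in> span F"
  shows "c f f \<le> \<theta> * m f f"
proof -
  have "c f f = c (\<Sum>e\<in>F. m f e *\<^sub>R e) f"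
    using orthonormal_expansion[OF F(1,2) f] by simp
  also have "\<dots> = (\<Sum>e\<in>F. c e e * (m f e)\<^sup>2)"
    unfolding c_simps
  proof (rule sum.cong[OF refl])
    fix e assume "e \<in> F"
    then have "c e f = c e e * m e f" by (intro eigenspaceD F)
    also have "m e f = m f e" by (rule form_commute[OF m_form])
    finally show "m f e * c e f = c e e * (m f e)\<^sup>2" by (simp add: power2_eq_square)
  qed
  also have "\<dots> \<le> (\<Sum>e\<in>F. \<theta> * (m f e)\<^sup>2)"
    by (intro sum_mono mult_right_mono F) auto
  also have "\<dots> = \<theta> * m f f" by (simp add: parseval[OF F(1,2) f] sum_distrib_left)
  finally show ?thesis .
qed

text \<open>
  This replaces the differentiation of eigenvalue branches at a crossing. Let \<open>F\<close> be spanned by the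
  eigenvectors with eigenvalues below \<open>\<mu>\<close>, and split the eigenspace of \<open>\<mu>\<close> into a part \<open>P\<close> on which \<open>b\<close>
  is positive and a part \<open>W\<close> on which \<open>b \<le> 0\<close>. Moving from \<open>c\<close> to \<open>c - \<epsilon> b\<close> lowers the form on \<open>P\<close>
  by an amount of order \<open>\<epsilon>\<close>, while the spectral gap on \<open>F\<close> absorbs all other terms; so \<open>F + P\<close> remains
  a test space at level \<open>\<mu>\<close>. Consequently at most \<open>card W\<close> of the eigenvalues equal to \<open>\<mu>\<close> can move
  above \<open>\<mu>\<close> immediately.
\<close>

lemma perturbed_test_space:
  fixes b :: "'v \<Rightarrow> 'v \<Rightarrow> real"
  assumes b: "symmetric_bilinear b"
  obtains k W \<epsilon>\<^sub>0 where
    "finite W" "independent W" "W \<subseteq> E \<mu>" "\<And>w. w \<in> span W \<Longrightarrow> b w w \<le> 0"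
    "eigenvalue_count c m \<mu> \<le> k + card W" "0 < \<epsilon>\<^sub>0"
    "\<And>\<epsilon>. 0 < \<epsilon> \<Longrightarrow> \<epsilon> \<le> \<epsilon>\<^sub>0 \<Longrightarrow>
       \<exists>B. finite B \<and> independent B \<and> card B = k \<and> (\<forall>z\<in>span B. c z z - \<epsilon> * b z z \<le> \<mu> * m z z)"
proof -
  note b_simps = form_simps[OF b]
  obtain S where S: "spectral_basis c m \<mu> S" using spectral_basis_exists by blast
  note SD = spectral_basisD[OF S]
  define F where "F = {e \<in> S. c e e < \<mu>}"
  define E0 where "E0 = {e \<in> S. c e e = \<mu>}"
  have split: "S = F \<union> E0" "F \<inter> E0 = {}" using SD(3) by (auto simp: F_def E0_def order.order_iff_strict)
  have finF: "finite F" and finE0: "finite E0" using SD(1) by (auto simp: F_def E0_def)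
  have onF: "orthonormal_for m F" and onE0: "orthonormal_for m E0"
    using orthonormal_for_subset[OF SD(2)] by (auto simp: F_def E0_def)
  have cardS: "card S = card F + card E0"
    using split finF finE0 card_Un_disjoint by metis
  have spanE0: "span E0 = E \<mu>" unfolding E0_def by (rule spectral_basis_spans_eigenspace[OF S order_refl])
  have F_eig: "e \<in> E (c e e)" "c e e < \<mu>" if "e \<in> F" for e
    using SD(4)[of e] that by (auto simp: F_def)
  obtain \<theta> where \<theta>: "\<theta> < \<mu>" "\<And>e. e \<in> F \<Longrightarrow> c e e \<le> \<theta>"
  proof
    \<comment> \<open>the extra element \<open>\<mu> - 1\<close> covers the case of an empty \<open>F\<close>\<close>
    let ?M = "Max (insert (\<mu> - 1) ((\<lambda>e. c e e) ` F))"
    show "?M < \<mu>" using finF by (auto simp: F_def)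
    show "c e e \<le> ?M" if "e \<in> F" for e using finF that by (intro Max_ge) auto
  qed
  obtain P W \<delta> where P: "finite P" "independent P" "P \<subseteq> span E0" "0 < \<delta>"
      "\<And>x. x \<in> span P \<Longrightarrow> \<delta> * m x x \<le> b x x"
    and W: "finite W" "independent W" "W \<subseteq> span E0" "\<And>w. w \<in> span W \<Longrightarrow> b w w \<le> 0"
    and card: "card E0 \<le> card P + card W"
    using positive_nonpositive_splitting[OF b finE0 orthonormal_independent[OF onE0]] by metis
  obtain C where C: "C \<ge> 0"
      "\<And>x y. x \<in> span S \<Longrightarrow> y \<in> span S \<Longrightarrow> \<bar>b x y\<bar> \<le> C * sqrt (m x x) * sqrt (m y y)"
    using form_bounded_on_finite_span[OF b SD(1)] by metis
  have spanP: "span P \<subseteq> E \<mu>" using P(3) spanE0 span_minimal subspace_eigenspace by metis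
  have FP_orth: "m p f = 0" if "f \<in> span F" "p \<in> span P" for f p
  proof (rule form_zero_on_span[OF m_form _ that(1)])
    fix e assume "e \<in> F"
    then show "m p e = 0"
      using eigenspaces_orthogonal[of p \<mu> e "c e e"] F_eig[of e] spanP that(2) by auto
  qed
  define B where "B i = (if i then F else P)" for i :: bool
  have direct: "w i = 0" if w: "\<And>i. i \<in> UNIV \<Longrightarrow> w i \<in> span (B i)" and 0: "(\<Sum>i\<in>UNIV. w i) = 0"
    for w i
  proof -
    have sum0: "w True + w False = 0" using 0 by (simp add: UNIV_bool add.commute)
    have wT: "w True \<in> span F" and wF: "w False \<in> span P" using w[of True] w[of False] by (auto simp: B_def)
    have "m (w True + w False) (w True) = m (w True) (w True)"
      using FP_orth[OF wT wF] by (simp add: m_simps)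
    then have "w True = 0" using sum0 by (simp add: m_simps m_eq_0_iff)
    with sum0 show ?thesis by (cases i) auto
  qed
  have finB: "finite (B i)" and iB: "independent (B i)" for i
    using finF P(1,2) orthonormal_independent[OF onF] by (auto simp: B_def)
  have indB: "independent (\<Union>i\<in>UNIV. B i)"
  proof (rule independent_Union_direct_sum)
    fix w i assume "\<And>i. i \<in> UNIV \<Longrightarrow> w i \<in> span (B i)" "(\<Sum>i\<in>UNIV. w i) = 0"
    then show "w i = 0" by (rule direct)
  qed (simp_all add: finB iB)
  have cardB: "card (\<Union>i\<in>UNIV. B i) = (\<Sum>i\<in>UNIV. card (B i))"
  proof (rule independent_Union_direct_sum)
    fix w i assume "\<And>i. i \<in> UNIV \<Longrightarrow> w i \<in> span (B i)" "(\<Sum>i\<in>UNIV. w i) = 0"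
    then show "w i = 0" by (rule direct)
  qed (simp_all add: finB iB)
  have UB: "(\<Union>i\<in>UNIV. B i) = F \<union> P" by (auto simp: B_def UNIV_bool)
  have indFP: "independent (F \<union> P)" using indB unfolding UB .
  have cardFP: "card (F \<union> P) = card F + card P"
    using cardB unfolding UB by (simp add: B_def UNIV_bool add.commute)
  \<comment> \<open>\<open>C X\<^sup>2\<close> bounds \<open>b\<close> on the part in \<open>F\<close>, and \<open>C\<^sup>2/\<delta> X\<^sup>2\<close> is what the mixed term costs after its \<open>Y\<^sup>2\<close>-part is absorbed by the positivity of \<open>b\<close> on \<open>P\<close>\<close>
  define L where "L = C + C\<^sup>2 / \<delta>"
  have L: "L \<ge> 0" using C(1) P(4) by (simp add: L_def)
  define \<epsilon>\<^sub>0 where "\<epsilon>\<^sub>0 = (\<mu> - \<theta>) / (L + 1)"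
  have \<epsilon>\<^sub>0: "0 < \<epsilon>\<^sub>0" using \<theta>(1) L by (simp add: \<epsilon>\<^sub>0_def)
  have "c z z - \<epsilon> * b z z \<le> \<mu> * m z z" if \<epsilon>: "0 < \<epsilon>" "\<epsilon> \<le> \<epsilon>\<^sub>0" and z: "z \<in> span (F \<union> P)" for \<epsilon> z
  proof -
    obtain f p where fp: "f \<in> span F" "p \<in> span P" "z = f + p" using z unfolding span_Un by blast
    define X where "X = sqrt (m f f)"
    define Y where "Y = sqrt (m p p)"
    have XY: "X \<ge> 0" "Y \<ge> 0" "X\<^sup>2 = m f f" "Y\<^sup>2 = m p p" using m_nonneg by (auto simp: X_def Y_def)
    have "f \<in> span S" using fp(1) span_mono[of F S] split(1) by auto
    have "span E0 \<subseteq> span S" using split(1) by (intro span_mono) auto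
    then have "p \<in> span S" using fp(2) spanP spanE0 by auto
    have bff: "\<bar>b f f\<bar> \<le> C * X\<^sup>2"
      using C(2)[OF \<open>f \<in> span S\<close> \<open>f \<in> span S\<close>] by (simp add: X_def[symmetric] power2_eq_square mult.assoc)
    have bfp: "\<bar>b f p\<bar> \<le> C * X * Y"
      using C(2)[OF \<open>f \<in> span S\<close> \<open>p \<in> span S\<close>] by (simp add: X_def Y_def)
    have bpp: "\<delta> * Y\<^sup>2 \<le> b p p" using P(5)[OF fp(2)] XY(4) by simp
    have cff: "c f f \<le> \<theta> * X\<^sup>2"
      using spectral_basis_quadratic_bound[OF finF onF F_eig(1) \<theta>(2) fp(1)] XY(3) by simp
    have cp: "c p v = \<mu> * m p v" for v using eigenspaceD spanP fp(2) by blast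
    have mpf: "m p f = 0" by (rule FP_orth[OF fp(1,2)])
    have "b p f = b f p" "c f p = c p f" "m f p = m p f" by (rule form_commute[OF b] form_commute[OF c_form] form_commute[OF m_form])+
    then have exp: "c z z = c f f + \<mu> * Y\<^sup>2" "m z z = X\<^sup>2 + Y\<^sup>2" "b z z = b f f + 2 * b f p + b p p"
      unfolding fp(3) XY(3,4) by (simp_all add: form_add_left[OF c_form] form_add_right[OF c_form]
          form_add_left[OF m_form] form_add_right[OF m_form] form_add_left[OF b] form_add_right[OF b] cp mpf)
    have "0 \<le> (\<delta> * Y - C * X)\<^sup>2 / \<delta>" using P(4) by simp
    also have "\<dots> = \<delta> * Y\<^sup>2 - 2 * C * X * Y + C\<^sup>2 / \<delta> * X\<^sup>2"
      using P(4) by (simp add: field_simps power2_eq_square)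
    finally have "- b z z \<le> L * X\<^sup>2"
      unfolding exp L_def using bff bfp bpp by (simp add: algebra_simps)
    then have "\<epsilon> * (- b z z) \<le> \<epsilon> * (L * X\<^sup>2)" using \<epsilon>(1) by (intro mult_left_mono) auto
    also have "\<dots> \<le> (\<mu> - \<theta>) * X\<^sup>2"
    proof -
      have "\<epsilon> * L \<le> \<epsilon>\<^sub>0 * (L + 1)" using \<epsilon> L by (intro mult_mono) auto
      also have "\<dots> = \<mu> - \<theta>" using L by (simp add: \<epsilon>\<^sub>0_def)
      finally have "\<epsilon> * L * X\<^sup>2 \<le> (\<mu> - \<theta>) * X\<^sup>2" by (intro mult_right_mono) auto
      then show ?thesis by (simp add: mult.assoc)
    qed
    finally show ?thesis using cff unfolding exp(1,2) by (simp add: algebra_simps)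
  qed
  then have pert: "\<exists>B. finite B \<and> independent B \<and> card B = card F + card P \<and>
      (\<forall>z\<in>span B. c z z - \<epsilon> * b z z \<le> \<mu> * m z z)" if "0 < \<epsilon>" "\<epsilon> \<le> \<epsilon>\<^sub>0" for \<epsilon>
    using that finF P(1) indFP cardFP by (intro exI[of _ "F \<union> P"]) auto
  have "eigenvalue_count c m \<mu> \<le> (card F + card P) + card W"
    using eigenvalue_count_eq_card[OF S] cardS card by simp
  then show ?thesis
    using that[OF W(1,2) _ W(4) _ \<epsilon>\<^sub>0 pert] W(3) spanE0 by blast
qed

end

section \<open>Coercive forms perturbed by weakly continuous forms\<close>

lemma weakly_continuous_tendsto:
  assumes "weakly_continuous_form c" "weakly_converges x u" "weakly_converges y v"
  shows "(\<lambda>k. c (x k) (y k)) \<longlonglongrightarrow> c u v"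
  using assms unfolding weakly_continuous_form_def by blast

text \<open>
  Needed since weak convergence is defined through the inner product, so that only bounded functionals are
  known to be weakly continuous. The bound on unit vectors comes from \<open>a (x \<plusminus> y) (x \<plusminus> y) \<ge> 0\<close>.
\<close>

lemma coercive_form_bounded_linear:
  assumes a: "symmetric_bilinear a" "continuous_coercive a"
  shows "bounded_linear (\<lambda>x. a x u)"
proof -
  obtain \<kappa>1 \<kappa>2 where \<kappa>: "0 < \<kappa>1" "\<kappa>1 \<le> \<kappa>2"
    "\<And>u. \<kappa>1 * (norm u)\<^sup>2 \<le> a u u" "\<And>u. a u u \<le> \<kappa>2 * (norm u)\<^sup>2"
    using a(2) unfolding continuous_coercive_def by blast
  have nonneg: "0 \<le> a v v" for v
  proof -
    have "0 \<le> \<kappa>1 * (norm v)\<^sup>2" using \<kappa>(1) by simp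
    then show ?thesis using \<kappa>(3)[of v] by (rule order_trans)
  qed
  \<comment> \<open>homogeneity reduces the general bound to unit vectors\<close>
  have bound: "\<bar>a x y\<bar> \<le> \<kappa>2" if "norm x = 1" "norm y = 1" for x y
  proof -
    have "0 \<le> a (x + y) (x + y)" "0 \<le> a (x - y) (x - y)" by (rule nonneg)+
    moreover have "a y x = a x y" by (rule form_commute[OF a(1)])
    ultimately have "2 * \<bar>a x y\<bar> \<le> a x x + a y y"
      by (auto simp: form_simps[OF a(1)])
    also have "\<dots> \<le> 2 * \<kappa>2" using \<kappa>(4)[of x] \<kappa>(4)[of y] that by simp
    finally show ?thesis by simp
  qed
  show ?thesis
  proof (rule bounded_linear_intro)
    show "a (x + y) u = a x u + a y u" "a (r *\<^sub>R x) u = r *\<^sub>R a x u" for x y r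
      by (simp_all add: form_simps[OF a(1)])
    show "norm (a x u) \<le> norm x * (\<kappa>2 * norm u)" for x
    proof (cases "x = 0 \<or> u = 0")
      case False
      then have "x = norm x *\<^sub>R sgn x" "u = norm u *\<^sub>R sgn u"
        by (simp_all add: sgn_div_norm)
      then have "a x u = norm x * (norm u * a (sgn x) (sgn u))"
        by (metis form_scale_left[OF a(1)] form_scale_right[OF a(1)])
      moreover have "\<bar>a (sgn x) (sgn u)\<bar> \<le> \<kappa>2" using False by (intro bound) (auto simp: norm_sgn)
      then have "norm x * (norm u * \<bar>a (sgn x) (sgn u)\<bar>) \<le> norm x * (norm u * \<kappa>2)"
        by (intro mult_left_mono) auto
      ultimately show ?thesis by (simp add: abs_mult mult_ac)
    qed (auto simp: form_simps[OF a(1)])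
  qed
qed

text \<open>
  Otherwise there would be unit vectors \<open>x\<^sub>k\<close> violating it with \<open>\<alpha> = \<kappa>/2\<close> and \<open>K = k\<close>. Then \<open>m\<close> tends to \<open>0\<close>
  along them, so a weak limit is \<open>0\<close>, and \<open>b\<close> tends to \<open>0\<close> as well; this contradicts \<open>a \<ge> \<kappa>\<close> on unit
  vectors.
\<close>

lemma garding_inequality:
  fixes a b m :: "'v::{real_inner, banach} \<Rightarrow> 'v \<Rightarrow> real"
  assumes sep: "separable_space (euclidean :: 'v topology)"
    and a: "symmetric_bilinear a" "continuous_coercive a"
    and b: "symmetric_bilinear b" "weakly_continuous_form b"
    and m: "symmetric_bilinear m" "weakly_continuous_form m" "\<And>u. u \<noteq> 0 \<Longrightarrow> m u u > 0"
  shows "\<exists>\<alpha> K. 0 < \<alpha> \<and> (\<forall>u. \<alpha> * (norm u)\<^sup>2 \<le> (a u u - r * b u u) + K * m u u)"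
proof -
  interpret positive_form m by unfold_locales (use m in auto)
  obtain \<kappa> where \<kappa>: "0 < \<kappa>" "\<And>u. \<kappa> * (norm u)\<^sup>2 \<le> a u u"
    using a(2) unfolding continuous_coercive_def by blast
  have "\<exists>K. \<forall>u. norm u = 1 \<longrightarrow> \<kappa> / 2 \<le> (a u u - r * b u u) + K * m u u"
  proof (rule ccontr)
    assume "\<not> ?thesis"
    then have "\<forall>k::nat. \<exists>u. norm u = 1 \<and> (a u u - r * b u u) + real k * m u u < \<kappa> / 2"
      by (metis not_le)
    then obtain x where x: "\<And>k::nat. norm (x k) = 1"
        "\<And>k. (a (x k) (x k) - r * b (x k) (x k)) + real k * m (x k) (x k) < \<kappa> / 2"
      by metis
    obtain \<rho> l where \<rho>: "strict_mono \<rho>" "weakly_converges (x \<circ> \<rho>) l"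
      using bounded_imp_weakly_convergent_subsequence[OF sep, of x 1] x(1) by auto
    define y where "y = x \<circ> \<rho>"
    have y: "real k * m (y k) (y k) < r * b (y k) (y k) - \<kappa> / 2" for k
    proof -
      have "real k * m (y k) (y k) \<le> real (\<rho> k) * m (y k) (y k)"
        using seq_suble[OF \<rho>(1), of k] m_nonneg by (intro mult_right_mono) auto
      moreover have "\<kappa> \<le> a (y k) (y k)" using \<kappa>(2)[of "y k"] x(1) by (simp add: y_def)
      ultimately show ?thesis using x(2)[of "\<rho> k"] by (simp add: y_def)
    qed
    have b_lim: "(\<lambda>k. r * b (y k) (y k) - \<kappa> / 2) \<longlonglongrightarrow> r * b l l - \<kappa> / 2"
      unfolding y_def by (intro tendsto_intros weakly_continuous_tendsto[OF b(2)] \<rho>)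
    have "(\<lambda>k. (r * b (y k) (y k) - \<kappa> / 2) * inverse (real k)) \<longlonglongrightarrow> (r * b l l - \<kappa> / 2) * 0"
      by (intro tendsto_mult b_lim lim_inverse_n)
    moreover have "(\<lambda>k. m (y k) (y k)) \<longlonglongrightarrow> m l l"
      unfolding y_def by (intro weakly_continuous_tendsto[OF m(2)] \<rho>)
    moreover have "m (y k) (y k) \<le> (r * b (y k) (y k) - \<kappa> / 2) * inverse (real k)" if "k \<ge> 1" for k
      using y[of k] that by (simp add: field_simps)
    ultimately have "m l l \<le> (r * b l l - \<kappa> / 2) * 0"
      by (intro LIMSEQ_le) auto
    then have "l = 0" using m_nonneg[of l] m_eq_0_iff[of l] by simp
    have "0 \<le> r * b (y k) (y k) - \<kappa> / 2" for k
    proof -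
      have "0 \<le> real k * m (y k) (y k)" using m_nonneg by simp
      with y[of k] show ?thesis by linarith
    qed
    then have "0 \<le> r * b l l - \<kappa> / 2"
      using LIMSEQ_le_const[OF b_lim] by blast
    then show False using \<kappa>(1) \<open>l = 0\<close> by (simp add: form_simps[OF b(1)])
  qed
  then obtain K where K: "\<And>u. norm u = 1 \<Longrightarrow> \<kappa> / 2 \<le> (a u u - r * b u u) + K * m u u" by blast
  have "\<kappa> / 2 * (norm u)\<^sup>2 \<le> (a u u - r * b u u) + K * m u u" for u
  proof (cases "u = 0")
    case False
    then have u: "u = norm u *\<^sub>R sgn u" by (simp add: sgn_div_norm)
    have scale: "g u u = (norm u)\<^sup>2 * g (sgn u) (sgn u)" if "symmetric_bilinear g" for g
      by (subst (1 2) u) (simp add: form_scale_left[OF that] form_scale_right[OF that] power2_eq_square)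
    have "(norm u)\<^sup>2 * (\<kappa> / 2) \<le> (norm u)\<^sup>2 * ((a (sgn u) (sgn u) - r * b (sgn u) (sgn u)) + K * m (sgn u) (sgn u))"
      using K[of "sgn u"] False by (intro mult_left_mono) (auto simp: norm_sgn)
    then show ?thesis
      unfolding scale[OF a(1)] scale[OF b(1)] scale[OF m(1)] by (simp add: algebra_simps)
  qed (simp add: form_simps[OF a(1)] form_simps[OF b(1)] form_simps[OF m(1)])
  then show ?thesis using \<kappa>(1) by (intro exI[of _ "\<kappa> / 2"] exI[of _ K]) auto
qed

text \<open>
  A nonnegative quadratic form lies above its tangents, and the tangents are weakly continuous.
\<close>

lemma coercive_form_weakly_lsc:
  fixes a :: "'v::{real_inner, banach} \<Rightarrow> 'v \<Rightarrow> real"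
  assumes a: "symmetric_bilinear a" "continuous_coercive a"
    and x: "weakly_converges x u" and lim: "(\<lambda>k. a (x k) (x k)) \<longlonglongrightarrow> L"
  shows "a u u \<le> L"
proof -
  obtain \<kappa> where \<kappa>: "0 < \<kappa>" "\<And>u. \<kappa> * (norm u)\<^sup>2 \<le> a u u"
    using a(2) unfolding continuous_coercive_def by blast
  have "2 * a (x k) u - a u u \<le> a (x k) (x k)" for k
  proof -
    have "0 \<le> \<kappa> * (norm (x k - u))\<^sup>2" using \<kappa>(1) by simp
    also have "\<dots> \<le> a (x k - u) (x k - u)" by (rule \<kappa>(2))
    also have "\<dots> = a (x k) (x k) - 2 * a (x k) u + a u u"
      using form_commute[OF a(1), of u "x k"] by (simp add: form_simps[OF a(1)])
    finally show ?thesis by simp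
  qed
  moreover have "(\<lambda>k. 2 * a (x k) u - a u u) \<longlonglongrightarrow> 2 * a u u - a u u"
    by (intro tendsto_intros weakly_converges_bounded_linear[OF x] coercive_form_bounded_linear a)
  ultimately have "2 * a u u - a u u \<le> L" using lim LIMSEQ_le by blast
  then show ?thesis by simp
qed

lemma garding_pair_of_coercive:
  fixes a b m :: "'v::{real_inner, banach} \<Rightarrow> 'v \<Rightarrow> real"
  assumes sep: "separable_space (euclidean :: 'v topology)"
    and a: "symmetric_bilinear a" "continuous_coercive a"
    and b: "symmetric_bilinear b" "weakly_continuous_form b"
    and m: "symmetric_bilinear m" "weakly_continuous_form m" "\<And>u. u \<noteq> 0 \<Longrightarrow> m u u > 0"
  shows "garding_pair m (\<lambda>u v. a u v - r * b u v)"
proof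
  show "symmetric_bilinear (\<lambda>u v. a u v - r * b u v)"
  proof (rule symmetric_bilinearI)
    show "a (x + y) z - r * b (x + y) z = (a x z - r * b x z) + (a y z - r * b y z)"
      "a (k *\<^sub>R x) y - r * b (k *\<^sub>R x) y = k * (a x y - r * b x y)" for x y z k
      by (simp_all add: form_simps[OF a(1)] form_simps[OF b(1)] algebra_simps)
    show "a x y - r * b x y = a y x - r * b y x" for x y
      by (simp only: form_commute[OF a(1), of x] form_commute[OF b(1), of x])
  qed
  show "\<exists>\<alpha> K. 0 < \<alpha> \<and> (\<forall>u. \<alpha> * (norm u)\<^sup>2 \<le> a u u - r * b u u + K * m u u)"
    by (rule garding_inequality[OF assms])
  fix x :: "nat \<Rightarrow> 'v" and u L
  assume x: "weakly_converges x u" and L: "(\<lambda>k. a (x k) (x k) - r * b (x k) (x k)) \<longlonglongrightarrow> L"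
  have "(\<lambda>k. (a (x k) (x k) - r * b (x k) (x k)) + r * b (x k) (x k)) \<longlonglongrightarrow> L + r * b u u"
    by (intro tendsto_intros L weakly_continuous_tendsto[OF b(2)] x)
  then have "a u u \<le> L + r * b u u"
    by (intro coercive_form_weakly_lsc[OF a x]) simp
  then show "a u u - r * b u u \<le> L" by simp
qed (use sep m in auto)

section \<open>Eigencurves of the pencil\<close>

lemma (in garding_pair) eigenvalue_nth_le_iff:
  fixes B :: "'v set"
  assumes "finite B" "independent B" "card B = n" "1 \<le> n"
  shows "eigenvalue_nth c m n \<le> \<mu> \<longleftrightarrow> n \<le> eigenvalue_count c m \<mu>"
proof
  obtain \<mu>' where "n \<le> eigenvalue_count c m \<mu>'"
    using card_le_eigenvalue_count_eventually assms by blast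
  then have "n \<le> eigenvalue_count c m (eigenvalue_nth c m n)"
    by (rule eigenvalue_nth_least(3)[OF assms(4)])
  moreover assume "eigenvalue_nth c m n \<le> \<mu>"
  ultimately show "n \<le> eigenvalue_count c m \<mu>"
    using eigenvalue_count_mono order_trans by blast
next
  assume "n \<le> eigenvalue_count c m \<mu>"
  then show "eigenvalue_nth c m n \<le> \<mu>" by (rule eigenvalue_nth_least(2)[OF assms(4)])
qed

text \<open>
  Turns the condition for the existence of the \<open>j\<close>-th eigencurve, which distinguishes finite and infinite
  dimension, into the existence of \<open>j\<close> independent vectors.
\<close>

lemma independent_set_of_card_exists:
  assumes "(\<exists>B :: ('v::real_vector) set. finite B \<and> span B = UNIV) \<longrightarrow> j \<le> dim (UNIV :: ('v::real_vector) set)"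
  obtains B :: "('v::real_vector) set" where "finite B" "independent B" "card B = j"
proof -
  obtain C :: "'v set" where C: "independent C" "UNIV \<subseteq> span C" "card C = dim (UNIV :: 'v set)"
    by (rule basis_exists[of "UNIV :: 'v set"])
  have "\<exists>B\<subseteq>C. finite B \<and> card B = j"
  proof (cases "finite C")
    case True
    have "span C = UNIV" using C(2) by auto
    with True assms C(3) have "j \<le> card C" by auto
    then obtain B where "B \<subseteq> C" "card B = j" "finite B" by (rule obtain_subset_with_card_n)
    then show ?thesis by blast
  next
    case False
    then show ?thesis using infinite_arbitrarily_large[of C j] by blast
  qed
  then obtain B where B: "B \<subseteq> C" "finite B" "card B = j" by blast
  from B(2) independent_mono[OF C(1) B(1)] B(3) show ?thesis by (rule that)
qed

text \<open>
  Eigenvectors of the pencil \<open>q - \<sigma> b\<close> for different \<open>\<sigma>\<close> are independent when \<open>q\<close> is nondegenerate: they are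
  eigenvectors of the operator \<open>q\<^sup>-\<^sup>1 b\<close> for the eigenvalues \<open>1/\<sigma>\<close>. The usual induction is carried out
  without constructing that operator.
\<close>

lemma pencil_eigenvectors_direct_sum:
  fixes q b :: "'v::real_vector \<Rightarrow> 'v \<Rightarrow> real"
  assumes q: "symmetric_bilinear q" and b: "symmetric_bilinear b"
    and nondegenerate: "\<And>u. (\<And>v. q u v = 0) \<Longrightarrow> u = 0"
    and "finite \<Sigma>" "0 \<notin> \<Sigma>"
    and "\<And>\<sigma> v. \<sigma> \<in> \<Sigma> \<Longrightarrow> q (w \<sigma>) v = \<sigma> * b (w \<sigma>) v"
    and "(\<Sum>\<sigma>\<in>\<Sigma>. w \<sigma>) = 0"
    and "\<sigma> \<in> \<Sigma>"
  shows "w \<sigma> = 0"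
  using assms(4-)
proof (induction \<Sigma> arbitrary: w \<sigma> rule: finite_induct)
  case empty
  then show ?case by simp
next
  case (insert \<tau> \<Sigma>)
  note q_simps = form_simps[OF q] and b_simps = form_simps[OF b]
  have \<tau>: "\<tau> \<noteq> 0" using insert.prems(1) by auto
  have nz: "\<sigma> \<noteq> 0" if "\<sigma> \<in> \<Sigma>" for \<sigma> using insert.prems(1) that by auto
  have sum0: "w \<tau> + (\<Sum>\<sigma>\<in>\<Sigma>. w \<sigma>) = 0" using insert.prems(3) insert.hyps by simp
  have "(1 / \<tau>) *\<^sub>R w \<tau> + (\<Sum>\<sigma>\<in>\<Sigma>. (1 / \<sigma>) *\<^sub>R w \<sigma>) = 0"
  proof (rule nondegenerate)
    fix v
    have "q ((1 / \<tau>) *\<^sub>R w \<tau> + (\<Sum>\<sigma>\<in>\<Sigma>. (1 / \<sigma>) *\<^sub>R w \<sigma>)) v =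
        (1 / \<tau>) * q (w \<tau>) v + (\<Sum>\<sigma>\<in>\<Sigma>. (1 / \<sigma>) * q (w \<sigma>) v)"
      by (simp only: q_simps)
    also have "(1 / \<tau>) * q (w \<tau>) v = b (w \<tau>) v" using insert.prems(2)[of \<tau> v] \<tau> by simp
    also have "(\<Sum>\<sigma>\<in>\<Sigma>. (1 / \<sigma>) * q (w \<sigma>) v) = (\<Sum>\<sigma>\<in>\<Sigma>. b (w \<sigma>) v)"
      using insert.prems(2) nz by (intro sum.cong) auto
    also have "b (w \<tau>) v + (\<Sum>\<sigma>\<in>\<Sigma>. b (w \<sigma>) v) = b (w \<tau> + (\<Sum>\<sigma>\<in>\<Sigma>. w \<sigma>)) v"
      by (simp only: b_simps)
    also have "\<dots> = 0" by (simp add: sum0 b_simps)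
    finally show "q ((1 / \<tau>) *\<^sub>R w \<tau> + (\<Sum>\<sigma>\<in>\<Sigma>. (1 / \<sigma>) *\<^sub>R w \<sigma>)) v = 0" .
  qed
  moreover have "(1 / \<tau>) *\<^sub>R (w \<tau> + (\<Sum>\<sigma>\<in>\<Sigma>. w \<sigma>)) = 0" by (simp add: sum0)
  ultimately have "(\<Sum>\<sigma>\<in>\<Sigma>. (1 / \<sigma>) *\<^sub>R w \<sigma>) - (1 / \<tau>) *\<^sub>R (\<Sum>\<sigma>\<in>\<Sigma>. w \<sigma>) = 0"
    unfolding scaleR_add_right by (metis add_diff_cancel_left diff_self)
  then have "(\<Sum>\<sigma>\<in>\<Sigma>. (1 / \<sigma> - 1 / \<tau>) *\<^sub>R w \<sigma>) = 0"
    by (simp add: scaleR_diff_left sum_subtractf scaleR_sum_right)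
  moreover have "q ((1 / \<sigma> - 1 / \<tau>) *\<^sub>R w \<sigma>) v = \<sigma> * b ((1 / \<sigma> - 1 / \<tau>) *\<^sub>R w \<sigma>) v" if "\<sigma> \<in> \<Sigma>" for \<sigma> v
    using insert.prems(2)[of \<sigma> v] that by (simp add: q_simps b_simps)
  ultimately have "(1 / \<sigma> - 1 / \<tau>) *\<^sub>R w \<sigma> = 0" if "\<sigma> \<in> \<Sigma>" for \<sigma>
    using insert.IH[of "\<lambda>\<sigma>. (1 / \<sigma> - 1 / \<tau>) *\<^sub>R w \<sigma>" \<sigma>] insert.prems(1) that by blast
  moreover have "1 / \<sigma> - 1 / \<tau> \<noteq> 0" if "\<sigma> \<in> \<Sigma>" for \<sigma>
    using insert.hyps(2) that nz \<tau> by auto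
  ultimately have zero: "w \<sigma> = 0" if "\<sigma> \<in> \<Sigma>" for \<sigma> using that by (metis scaleR_eq_0_iff)
  then have "w \<tau> = 0" using sum0 by simp
  with zero show ?case using insert.prems(4) by auto
qed

locale eigencurve_pencil =
  fixes a b m :: "'v::{real_inner, banach} \<Rightarrow> 'v \<Rightarrow> real" and \<mu>s :: real
  assumes separable: "separable_space (euclidean :: 'v topology)"
    and a_form: "symmetric_bilinear a" and a_coercive: "continuous_coercive a"
    and b_form: "symmetric_bilinear b" and b_weak: "weakly_continuous_form b"
    and m_form: "symmetric_bilinear m" and m_weak: "weakly_continuous_form m"
    and m_pos: "u \<noteq> 0 \<Longrightarrow> m u u > 0"
    and nonresonant: "\<mu>s \<notin> form_spectrum a m"
begin

abbreviation pencil where "pencil r \<equiv> (\<lambda>u v. a u v - r * b u v)"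

lemma garding_pair_pencil: "garding_pair m (pencil r)"
  by (rule garding_pair_of_coercive[OF separable a_form a_coercive b_form b_weak m_form m_weak m_pos])

lemma component_counts:
  assumes "eigencurve_component a b m \<mu>s j s t"
  shows "1 \<le> j" "j \<le> eigenvalue_count (pencil s) m \<mu>s" "\<mu>s \<in> form_spectrum (pencil s) m"
    "s < r \<Longrightarrow> r < t \<Longrightarrow> eigenvalue_count (pencil r) m \<mu>s < j"
proof -
  note comp = assms[unfolded eigencurve_component_def eigencurve_def]
  show j: "1 \<le> j" using comp by blast
  obtain B :: "'v set" where B: "finite B" "independent B" "card B = j"
    using comp independent_set_of_card_exists by blast
  have nth: "eigenvalue_nth (pencil s) m j = \<mu>s" using comp by blast
  then show count: "j \<le> eigenvalue_count (pencil s) m \<mu>s"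
    using garding_pair.eigenvalue_nth_le_iff[OF garding_pair_pencil B j] by blast
  show "\<mu>s \<in> form_spectrum (pencil s) m"
    using garding_pair.eigenvalue_nth_least(1)[OF garding_pair_pencil j count] nth by simp
  show "eigenvalue_count (pencil r) m \<mu>s < j" if "s < r" "r < t"
  proof -
    have "\<not> eigenvalue_nth (pencil r) m j \<le> \<mu>s" using comp that by (simp add: not_le)
    then show ?thesis
      using garding_pair.eigenvalue_nth_le_iff[OF garding_pair_pencil B j] not_le by blast
  qed
qed

text \<open>
  If \<open>k\<close> is the dimension of the test space that persists just to the right of \<open>\<sigma>\<close>, then a curve that
  passes through \<open>(\<sigma>, \<mu>s)\<close> and lies above \<open>\<mu>s\<close> to the right of \<open>\<sigma>\<close> has an index greater than \<open>k\<close> and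
  at most \<open>k + card W\<close>. Distinct curves have distinct indices.
\<close>

lemma components_with_common_left_end:
  assumes fin: "finite I"
    and comp: "\<And>i. i \<in> I \<Longrightarrow> eigencurve_component a b m \<mu>s (j i) \<sigma> (t i)"
    and inj: "inj_on j I"
  shows "\<exists>W. finite W \<and> independent W \<and> W \<subseteq> form_eigenspace (pencil \<sigma>) m \<mu>s \<and>
    (\<forall>w\<in>span W. b w w \<le> 0) \<and> card I \<le> card W"
proof -
  interpret G: garding_pair m "pencil \<sigma>" by (rule garding_pair_pencil)
  obtain k W \<epsilon>\<^sub>0 where W: "finite W" "independent W" "W \<subseteq> G.E \<mu>s" "\<And>w. w \<in> span W \<Longrightarrow> b w w \<le> 0"
    and count: "eigenvalue_count (pencil \<sigma>) m \<mu>s \<le> k + card W" and \<epsilon>\<^sub>0: "0 < \<epsilon>\<^sub>0"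
    and pert: "\<And>\<epsilon>. 0 < \<epsilon> \<Longrightarrow> \<epsilon> \<le> \<epsilon>\<^sub>0 \<Longrightarrow> \<exists>B. finite B \<and> independent B \<and> card B = k \<and>
        (\<forall>z\<in>span B. pencil \<sigma> z z - \<epsilon> * b z z \<le> \<mu>s * m z z)"
    by (rule G.perturbed_test_space[OF b_form, of \<mu>s]) (rule that)
  have "j i \<in> {k<..k + card W}" if i: "i \<in> I" for i
  proof -
    have "\<sigma> < t i" using comp[OF i] by (simp add: eigencurve_component_def)
    \<comment> \<open>a point inside the component, close enough to its left end for the perturbed test space\<close>
    define \<epsilon> where "\<epsilon> = min \<epsilon>\<^sub>0 ((t i - \<sigma>) / 2)"
    have \<epsilon>: "0 < \<epsilon>" "\<epsilon> \<le> \<epsilon>\<^sub>0" "\<sigma> + \<epsilon> < t i"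
      using \<epsilon>\<^sub>0 \<open>\<sigma> < t i\<close> by (auto simp: \<epsilon>_def min_def field_simps)
    obtain B where B: "finite B" "independent B" "card B = k"
        "\<And>z. z \<in> span B \<Longrightarrow> pencil \<sigma> z z - \<epsilon> * b z z \<le> \<mu>s * m z z"
      using pert[OF \<epsilon>(1,2)] by blast
    have "pencil (\<sigma> + \<epsilon>) z z \<le> \<mu>s * m z z" if "z \<in> span B" for z
      using B(4)[OF that] by (simp add: algebra_simps)
    then have "k \<le> eigenvalue_count (pencil (\<sigma> + \<epsilon>)) m \<mu>s"
      using garding_pair.card_le_eigenvalue_count[OF garding_pair_pencil B(1,2)] B(3) by blast
    also have "\<dots> < j i" using \<epsilon> by (intro component_counts(4)[OF comp[OF i]]) auto
    finally show ?thesis using component_counts(2)[OF comp[OF i]] count by simp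
  qed
  then have "card (j ` I) \<le> card {k<..k + card W}" by (intro card_mono) auto
  then have "card I \<le> card W" using inj by (simp add: card_image)
  then show ?thesis using W by blast
qed

lemma component_right_end_unique:
  assumes "eigencurve_component a b m \<mu>s j s t" "eigencurve_component a b m \<mu>s j s t'"
  shows "t = t'"
proof (rule ccontr)
  assume "t \<noteq> t'"
  then consider "t < t'" | "t' < t" by linarith
  then show False using assms unfolding eigencurve_component_def by cases force+
qed

text \<open>
  The spaces \<open>W \<sigma>\<close> attached to the different left endpoints are \<open>b\<close>-orthogonal to each other and form a
  direct sum, of dimension at least \<open>n\<close>. On this sum, \<open>a - r b - \<mu>s m\<close> equals
  \<open>\<Sum>\<sigma>. (\<sigma> - r) b (w \<sigma>) (w \<sigma>)\<close>, which is nonpositive when \<open>r\<close> lies to the left of all \<open>\<sigma>\<close>.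
\<close>

theorem eigencurve_le_left_of_components:
  fixes s t :: "nat \<Rightarrow> real" and j :: "nat \<Rightarrow> nat"
  assumes n: "1 \<le> n"
    and comp: "\<And>i. i \<in> {1..n} \<Longrightarrow> eigencurve_component a b m \<mu>s (j i) (s i) (t i)"
    and distinct: "\<And>i k. i \<in> {1..n} \<Longrightarrow> k \<in> {1..n} \<Longrightarrow> i \<noteq> k \<Longrightarrow> (s i, t i) = (s k, t k) \<Longrightarrow> j i \<noteq> j k"
    and r: "\<And>i. i \<in> {1..n} \<Longrightarrow> r \<le> s i"
  shows "eigencurve a b m n r \<le> \<mu>s"
proof -
  define q where "q u v = a u v - \<mu>s * m u v" for u v
  have q_form: "symmetric_bilinear q"
  proof (rule symmetric_bilinearI)
    show "q (x + y) z = q x z + q y z" "q (k *\<^sub>R x) y = k * q x y" for x y z k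
      by (simp_all add: q_def form_simps[OF a_form] form_simps[OF m_form] algebra_simps)
    show "q x y = q y x" for x y
      by (simp only: q_def form_commute[OF a_form, of x] form_commute[OF m_form, of x])
  qed
  have nondegenerate: "u = 0" if "\<And>v. q u v = 0" for u
    using nonresonant that unfolding q_def form_spectrum_def by (auto simp: eq_iff_diff_eq_0[symmetric])
  define \<Sigma> where "\<Sigma> = s ` {1..n}"
  define I where "I \<sigma> = {i \<in> {1..n}. s i = \<sigma>}" for \<sigma>
  \<comment> \<open>at \<open>r = 0\<close> the pencil is \<open>a\<close>, of which \<open>\<mu>s\<close> is not an eigenvalue\<close>
  have "0 \<notin> \<Sigma>"
  proof
    assume "0 \<in> \<Sigma>"
    then obtain i where "i \<in> {1..n}" "s i = 0" unfolding \<Sigma>_def by (metis imageE)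
    then show False using component_counts(3)[OF comp, of i] nonresonant by simp
  qed
  have "\<exists>W. finite W \<and> independent W \<and> W \<subseteq> form_eigenspace (pencil \<sigma>) m \<mu>s \<and>
    (\<forall>w\<in>span W. b w w \<le> 0) \<and> card (I \<sigma>) \<le> card W" for \<sigma>
  proof (rule components_with_common_left_end)
    show "finite (I \<sigma>)" by (simp add: I_def)
    show "eigencurve_component a b m \<mu>s (j i) \<sigma> (t i)" if "i \<in> I \<sigma>" for i
      using comp[of i] that by (auto simp: I_def)
    show "inj_on j (I \<sigma>)"
    proof (rule inj_onI, rule ccontr)
      fix i k assume ik: "i \<in> I \<sigma>" "k \<in> I \<sigma>" "j i = j k" "i \<noteq> k"
      \<comment> \<open>components of one curve with a common left end have a common right end, so distinctness applies\<close>
      then have "t i = t k"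
        using comp[of i] comp[of k] component_right_end_unique[of "j k" \<sigma> "t i" "t k"]
        by (auto simp: I_def)
      then show False using distinct[of i k] ik by (auto simp: I_def)
    qed
  qed
  then have "\<forall>\<sigma>. \<exists>W. finite W \<and> independent W \<and> W \<subseteq> form_eigenspace (pencil \<sigma>) m \<mu>s \<and>
    (\<forall>w\<in>span W. b w w \<le> 0) \<and> card (I \<sigma>) \<le> card W" ..
  from choice[OF this] obtain W where W_all: "\<forall>\<sigma>. finite (W \<sigma>) \<and> independent (W \<sigma>) \<and>
    W \<sigma> \<subseteq> form_eigenspace (pencil \<sigma>) m \<mu>s \<and> (\<forall>w\<in>span (W \<sigma>). b w w \<le> 0) \<and> card (I \<sigma>) \<le> card (W \<sigma>)"
    ..
  have W: "finite (W \<sigma>)" "independent (W \<sigma>)" "W \<sigma> \<subseteq> form_eigenspace (pencil \<sigma>) m \<mu>s"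
      "w \<in> span (W \<sigma>) \<Longrightarrow> b w w \<le> 0" "card (I \<sigma>) \<le> card (W \<sigma>)" for \<sigma> w
    using W_all by blast+
  have eig: "q w v = \<sigma> * b w v" if w: "w \<in> span (W \<sigma>)" for \<sigma> w v
  proof -
    interpret G: garding_pair m "pencil \<sigma>" by (rule garding_pair_pencil)
    have "w \<in> G.E \<mu>s" using w W(3) G.subspace_eigenspace span_minimal by blast
    then have "pencil \<sigma> w v = \<mu>s * m w v" by (rule G.eigenspaceD)
    then show ?thesis by (simp add: q_def)
  qed
  define U where "U = (\<Union>\<sigma>\<in>\<Sigma>. W \<sigma>)"
  have fin\<Sigma>: "finite \<Sigma>" by (simp add: \<Sigma>_def)
  have direct: "w \<sigma> = 0"
    if "\<And>\<sigma>. \<sigma> \<in> \<Sigma> \<Longrightarrow> w \<sigma> \<in> span (W \<sigma>)" "(\<Sum>\<sigma>\<in>\<Sigma>. w \<sigma>) = 0" "\<sigma> \<in> \<Sigma>" for w \<sigma>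
    using nondegenerate eig that
    by (intro pencil_eigenvectors_direct_sum[OF q_form b_form _ fin\<Sigma> \<open>0 \<notin> \<Sigma>\<close>, of w]) blast+
  have "independent U"
    unfolding U_def using fin\<Sigma> W(1,2) direct by (rule independent_Union_direct_sum)
  have cardU: "card U = (\<Sum>\<sigma>\<in>\<Sigma>. card (W \<sigma>))"
    unfolding U_def using fin\<Sigma> W(1,2) direct by (rule independent_Union_direct_sum)
  have "finite U" using fin\<Sigma> W(1) by (simp add: U_def)
  have "n = (\<Sum>\<sigma>\<in>\<Sigma>. card (I \<sigma>))"
    using sum.image_gen[of "{1..n}" "\<lambda>_. 1::nat" s] by (simp add: \<Sigma>_def I_def)
  then have n_le: "n \<le> card U" unfolding cardU using W(5) by (simp add: sum_mono)
  have "pencil r z z \<le> \<mu>s * m z z" if "z \<in> span U" for z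
  proof -
    have "z \<in> span (\<Union>\<sigma>\<in>\<Sigma>. W \<sigma>)" using that unfolding U_def .
    then obtain w where w: "\<And>\<sigma>. \<sigma> \<in> \<Sigma> \<Longrightarrow> w \<sigma> \<in> span (W \<sigma>)" and z: "z = (\<Sum>\<sigma>\<in>\<Sigma>. w \<sigma>)"
      by (rule span_Union_finite_decompose[OF fin\<Sigma>]) (rule that)
    have orth: "b (w \<sigma>) (w \<tau>) = 0" if "\<sigma> \<in> \<Sigma>" "\<tau> \<in> \<Sigma>" "\<sigma> \<noteq> \<tau>" for \<sigma> \<tau>
    proof -
      have "\<sigma> * b (w \<sigma>) (w \<tau>) = q (w \<sigma>) (w \<tau>)" by (rule eig[OF w[OF that(1)], symmetric])
      also have "\<dots> = q (w \<tau>) (w \<sigma>)" by (rule form_commute[OF q_form])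
      also have "\<dots> = \<tau> * b (w \<tau>) (w \<sigma>)" by (rule eig[OF w[OF that(2)]])
      also have "b (w \<tau>) (w \<sigma>) = b (w \<sigma>) (w \<tau>)" by (rule form_commute[OF b_form])
      finally show ?thesis using that(3) by simp
    qed
    have bz: "b (w \<sigma>) z = b (w \<sigma>) (w \<sigma>)" if "\<sigma> \<in> \<Sigma>" for \<sigma>
    proof -
      have "b (w \<sigma>) z = (\<Sum>\<tau>\<in>\<Sigma>. if \<tau> = \<sigma> then b (w \<sigma>) (w \<sigma>) else 0)"
        unfolding z form_sum_right[OF b_form] using orth that by (intro sum.cong) auto
      then show ?thesis using fin\<Sigma> that by simp
    qed
    have "q z z = (\<Sum>\<sigma>\<in>\<Sigma>. q (w \<sigma>) z)"
      by (subst (1) z) (rule form_sum_left[OF q_form])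
    also have "\<dots> = (\<Sum>\<sigma>\<in>\<Sigma>. \<sigma> * b (w \<sigma>) (w \<sigma>))"
      by (intro sum.cong refl) (simp add: eig[OF w] bz)
    finally have qzz: "q z z = (\<Sum>\<sigma>\<in>\<Sigma>. \<sigma> * b (w \<sigma>) (w \<sigma>))" .
    have "b z z = (\<Sum>\<sigma>\<in>\<Sigma>. b (w \<sigma>) z)"
      by (subst (1) z) (rule form_sum_left[OF b_form])
    also have "\<dots> = (\<Sum>\<sigma>\<in>\<Sigma>. b (w \<sigma>) (w \<sigma>))"
      using bz by (intro sum.cong) auto
    finally have bzz: "b z z = (\<Sum>\<sigma>\<in>\<Sigma>. b (w \<sigma>) (w \<sigma>))" .
    have "q z z - r * b z z = (\<Sum>\<sigma>\<in>\<Sigma>. (\<sigma> - r) * b (w \<sigma>) (w \<sigma>))"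
      unfolding qzz bzz by (simp add: sum_distrib_left sum_subtractf left_diff_distrib)
    also have "\<dots> \<le> 0"
    proof (intro sum_nonpos mult_nonneg_nonpos)
      fix \<sigma> assume \<sigma>: "\<sigma> \<in> \<Sigma>"
      show "0 \<le> \<sigma> - r" using \<sigma> r by (auto simp: \<Sigma>_def)
      show "b (w \<sigma>) (w \<sigma>) \<le> 0" by (rule W(4)[OF w[OF \<sigma>]])
    qed
    finally show ?thesis by (simp add: q_def)
  qed
  then have "card U \<le> eigenvalue_count (pencil r) m \<mu>s"
    using garding_pair.card_le_eigenvalue_count[OF garding_pair_pencil \<open>finite U\<close> \<open>independent U\<close>] by blast
  then show ?thesis
    using garding_pair.eigenvalue_nth_least(2)[OF garding_pair_pencil n] n_le
    by (simp add: eigencurve_def)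
qed

end

section \<open>Reflection and the bound on both sides\<close>

text \<open>
  Replacing \<open>b\<close> by \<open>-b\<close> reflects the eigencurves at \<open>r = 0\<close> and turns right endpoints into left endpoints.
  This is how the bound to the right of the components follows from the bound to the left.
\<close>

lemma eigencurve_reflect: "eigencurve a (\<lambda>u v. - b u v) m n r = eigencurve a b m n (- r)"
  by (simp add: eigencurve_def)

lemma eigencurve_component_reflect:
  assumes "eigencurve_component a b m \<mu>s j s t"
  shows "eigencurve_component a (\<lambda>u v. - b u v) m \<mu>s j (- t) (- s)"
proof -
  have "eigencurve a b m j (- r) > \<mu>s" if "- t < r" "r < - s" for r
    using assms that unfolding eigencurve_component_def by (auto simp: minus_less_iff less_minus_iff)
  with assms show ?thesis unfolding eigencurve_component_def eigencurve_reflect by auto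
qed

theorem theorem10p4:
  fixes a b m :: "'v::{real_inner, banach} \<Rightarrow> 'v \<Rightarrow> real"
    and \<mu>s :: real
    and n :: nat
    and s t :: "nat \<Rightarrow> real"
    and j :: "nat \<Rightarrow> nat"
  assumes separable: "separable_space (euclidean :: 'v topology)"
    and a_form: "symmetric_bilinear a" and a_coercive: "continuous_coercive a"
    and b_form: "symmetric_bilinear b" and b_weak: "weakly_continuous_form b"
    and m_form: "symmetric_bilinear m" and m_weak: "weakly_continuous_form m"
    and m_pos: "\<And>u. u \<noteq> 0 \<Longrightarrow> m u u > 0"
    and nonresonant: "\<mu>s \<notin> form_spectrum a m"
    and n_pos: "1 \<le> n"
    and components: "\<And>i. i \<in> {1..n} \<Longrightarrow> eigencurve_component a b m \<mu>s (j i) (s i) (t i)"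
    and distinct_curves:
      "\<And>i k. i \<in> {1..n} \<Longrightarrow> k \<in> {1..n} \<Longrightarrow> i \<noteq> k \<Longrightarrow> (s i, t i) = (s k, t k) \<Longrightarrow> j i \<noteq> j k"
  shows "\<forall>r \<in> {..Min (s ` {1..n})} \<union> {Max (t ` {1..n})..}. eigencurve a b m n r \<le> \<mu>s"
proof
  fix r assume "r \<in> {..Min (s ` {1..n})} \<union> {Max (t ` {1..n})..}"
  then consider "r \<le> Min (s ` {1..n})" | "Max (t ` {1..n}) \<le> r" by auto
  then show "eigencurve a b m n r \<le> \<mu>s"
  proof cases
    case 1
    interpret eigencurve_pencil a b m \<mu>s
      by unfold_locales (fact separable a_form a_coercive b_form b_weak m_form m_weak m_pos nonresonant)+
    have "r \<le> s i" if "i \<in> {1..n}" for i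
      using 1 Min_le[of "s ` {1..n}" "s i"] that by simp
    with n_pos components distinct_curves show ?thesis
      by (rule eigencurve_le_left_of_components[where s = s and t = t and j = j])
  next
    case 2
    have neg_form: "symmetric_bilinear (\<lambda>u v. - b u v)"
    proof (rule symmetric_bilinearI)
      show "- b (x + y) z = - b x z + - b y z" "- b (k *\<^sub>R x) y = k * - b x y" for x y z k
        by (simp_all add: form_simps[OF b_form])
      show "- b x y = - b y x" for x y by (simp only: form_commute[OF b_form, of x])
    qed
    have neg_weak: "weakly_continuous_form (\<lambda>u v. - b u v)"
      using b_weak unfolding weakly_continuous_form_def by (auto intro: tendsto_minus)
    interpret eigencurve_pencil a "\<lambda>u v. - b u v" m \<mu>s
      by unfold_locales (fact separable a_form a_coercive neg_form neg_weak m_form m_weak m_pos nonresonant)+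
    have "eigencurve a (\<lambda>u v. - b u v) m n (- r) \<le> \<mu>s"
    proof (rule eigencurve_le_left_of_components[OF n_pos])
      show "eigencurve_component a (\<lambda>u v. - b u v) m \<mu>s (j i) (- t i) (- s i)" if "i \<in> {1..n}" for i
        using components[OF that] by (rule eigencurve_component_reflect)
      show "j i \<noteq> j k" if "i \<in> {1..n}" "k \<in> {1..n}" "i \<noteq> k" "(- t i, - s i) = (- t k, - s k)" for i k
        using distinct_curves[OF that(1-3)] that(4) by simp
      show "- r \<le> - t i" if "i \<in> {1..n}" for i
        using 2 Max_ge[of "t ` {1..n}" "t i"] that by simp
    qed
    then show ?thesis by (simp add: eigencurve_reflect)
  qed
qed

end
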